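(* Let $\mathcal P=[X:\mathcal R]$ be an inverse monoid presentation of an inverse monoid $M$. Then the $M$-modules $$\mathcal K=\bigsqcup_{e\in E(M)}K_e^{ab}\qquad\text{and}\qquad \mathcal H=\bigsqcup_{e\in E(M)}H_1(\mathrm{Sch}^{\mathcal L}(M,X,e))$$ are isomorphic, where $\mathcal K$ is the relation module of $\mathcal P$ and $\mathrm{Sch}^{\mathcal L}(M,X,e)$ is the component of $e$ in the left Schützenberger graph of $(M,X)$.
   Context: Maps are written on the right and composed left to right. $E(S)$ is the semilattice of idempotents of an inverse semigroup $S$, and $\leq$ the natural partial order. **Presentation and factorisation.** $A=X\sqcup X^{-1}$, $A^*$ is the free monoid on $A$, $\mathcal R\subseteq A^*\times A^*$; $\rho:A^*\to \mathrm{FIM}(X)$ is the canonical map to the free inverse monoid; $M$ is the quotient of $\mathrm{FIM}(X)$ by the congruence generated by the pairs $(l\rho,r\rho)$, $(l,r)\in\mathcal R$, with quotient map $\theta:\mathrm{FIM}(X)\to M$. Let $\theta_{\min}$ be the congruence on $\mathrm{FIM}(X)$: $a\,\theta_{\min}\,b$ iff there is an idempotent $e$ with $ae=be$ and $(a^{-1}a)\theta=e\theta=(b^{-1}b)\theta$. Put $\mathcal T=\mathrm{FIM}(X)/\theta_{\min}$, with quotient map $\tau$ and induced map $\psi:\mathcal T\to M$, so $\theta=\tau\psi$. Here $\tau$ is idempotent pure and $\psi$ is surjective and idempotent separating. **$M$-modules (Lausch).** An $M$-module is a presheaf of abelian groups $(A_e,\alpha^e_f)$ over $E(M)$ (homomorphisms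 $\alpha^e_f:A_e\to A_f$ for $f\leq e$, with $\alpha^e_e=\mathrm{id}$, $\alpha^e_f\alpha^f_g=\alpha^e_g$), with $A=\bigsqcup_e A_e$ carrying the operation $a\oplus b=a\alpha^e_{ef}+b\alpha^f_{ef}$ ($a\in A_e$, $b\in A_f$), together with a map $A\times M\to A$, $(a,s)\mapsto a\lhd s$, such that $(a\oplus b)\lhd s=(a\lhd s)\oplus(b\lhd s)$, $a\lhd st=(a\lhd s)\lhd t$, $a\lhd e=a\oplus 0_e$ and $0_e\lhd s=0_{s^{-1}es}$ for all $a,b\in A$, $s,t\in M$, $e\in E(M)$. **Relation module.** For $e\in E(M)$ let $K_e=\{a\in\mathcal T:a\psi=e\}$, a group. The relation module is $\mathcal K=\bigsqcup_{e\in E(M)}K_e^{ab}$ with $M$-action $\bar k\lhd m=\overline{t^{-1}kt}$ for any $t\in\mathcal T$ with $t\psi=m$. **Schützenberger graph and homology.** The left Schützenberger graph $\mathrm{Sch}^{\mathcal L}(M,X)$ has vertex set $M$ and, for $x\in X$ and $s\in M$ with $(x^{-1}x)\theta\geq ss^{-1}$, an $x$-labelled edge $(x,s)$ from $s$ to $(x\theta)s$. The connected component $\mathrm{Sch}^{\mathcal L}(M,X,e)$ containing $e\in E(M)$ is the full subgraph on the $\mathcal L$-class $L_e=\{s:s^{-1}s=e\}$. Its chain groups are: $C_0$, free abelian on $L_e$, and $C_1$, free abelian on $\{(x,s):x\in X,\ s\in M,\ (x^{-1}x)\theta\geq ss^{-1},\ s^{-1}s=e\}$, with boundary $\partial(x,s)=(x\theta)s-s$;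 $H_1(\mathrm{Sch}^{\mathcal L}(M,X,e))=\ker\partial$. The families of groups $C_0$ and $C_1$ (indexed by $e\in E(M)$) are $M$-modules via $s\lhd t=st$ and $(x,s)\lhd t=(x,st)$, $\partial$ is an $M$-module map, and $\mathcal H$ carries the resulting $M$-module structure as the kernel of $\partial$. *)

theory Defs
  imports "HOL-Algebra.Generated_Groups" "HOL-Algebra.Free_Abelian_Groups"
begin

section \<open>Inverse monoids\<close>

definition inverse_pair :: "('a, 'b) monoid_scheme \<Rightarrow> 'a \<Rightarrow> 'a \<Rightarrow> bool" where
  "inverse_pair M a b \<longleftrightarrow>
     a \<otimes>\<^bsub>M\<^esub> b \<otimes>\<^bsub>M\<^esub> a = a \<and> b \<otimes>\<^bsub>M\<^esub> a \<otimes>\<^bsub>M\<^esub> b = b"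

locale inverse_monoid = monoid M for M (structure) +
  assumes ex1_inverse: "a \<in> carrier M \<Longrightarrow> \<exists>!b. b \<in> carrier M \<and> inverse_pair M a b"

text \<open>The inverse in the sense of inverse semigroups; \<^const>\<open>m_inv\<close> is the inverse of a unit
  and is only used for the groups below.\<close>

definition sinv :: "('a, 'b) monoid_scheme \<Rightarrow> 'a \<Rightarrow> 'a" where
  "sinv M a = (THE b. b \<in> carrier M \<and> inverse_pair M a b)"

definition idems :: "('a, 'b) monoid_scheme \<Rightarrow> 'a set" where
  "idems M = {e \<in> carrier M. e \<otimes>\<^bsub>M\<^esub> e = e}"

definition nat_le :: "('a, 'b) monoid_scheme \<Rightarrow> 'a \<Rightarrow> 'a \<Rightarrow> bool" where
  "nat_le M a b \<longleftrightarrow> a \<in> carrier M \<and> b \<in> carrier M \<and> (\<exists>e\<in>idems M. a = e \<otimes>\<^bsub>M\<^esub> b)"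


section \<open>Congruences and quotients\<close>

definition congruence :: "('a, 'b) monoid_scheme \<Rightarrow> ('a \<times> 'a) set \<Rightarrow> bool" where
  "congruence S r \<longleftrightarrow> equiv (carrier S) r \<and>
     (\<forall>a b c d. (a, b) \<in> r \<longrightarrow> (c, d) \<in> r \<longrightarrow> (a \<otimes>\<^bsub>S\<^esub> c, b \<otimes>\<^bsub>S\<^esub> d) \<in> r)"

definition cong_gen :: "('a, 'b) monoid_scheme \<Rightarrow> ('a \<times> 'a) set \<Rightarrow> ('a \<times> 'a) set" where
  "cong_gen S R = \<Inter>{r. congruence S r \<and> R \<subseteq> r}"

text \<open>For a congruence \<open>r\<close>, the union in the product runs over equal classes.\<close>

definition quot_monoid :: "('a, 'b) monoid_scheme \<Rightarrow> ('a \<times> 'a) set \<Rightarrow> 'a set monoid" where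
  "quot_monoid S r = \<lparr>
     carrier = carrier S // r,
     mult = (\<lambda>A B. \<Union>a\<in>A. \<Union>b\<in>B. r `` {a \<otimes>\<^bsub>S\<^esub> b}),
     one = r `` {\<one>\<^bsub>S\<^esub>}\<rparr>"


section \<open>Modules over an inverse monoid\<close>

text \<open>The group operations of the abelian groups \<open>A\<^sub>e = fib A e\<close> are written multiplicatively.
  \<open>res A e f\<close> is the map from \<open>A\<^sub>e\<close> to \<open>A\<^sub>f\<close>, meaningful for \<open>f \<le> e\<close>. The elements of the
  disjoint union of the \<open>A\<^sub>e\<close> are the pairs \<open>(e, a)\<close> with \<open>a\<close> in \<open>A\<^sub>e\<close>.\<close>

record ('m, 'a) lmodule =
  fib :: "'m \<Rightarrow> 'a monoid"
  res :: "'m \<Rightarrow> 'm \<Rightarrow> 'a \<Rightarrow> 'a"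
  act :: "'m \<times> 'a \<Rightarrow> 'm \<Rightarrow> 'm \<times> 'a"

definition total :: "('m, 'b) monoid_scheme \<Rightarrow> ('m, 'a) lmodule \<Rightarrow> ('m \<times> 'a) set" where
  "total M A = Sigma (idems M) (\<lambda>e. carrier (fib A e))"

definition oplus ::
  "('m, 'b) monoid_scheme \<Rightarrow> ('m, 'a) lmodule \<Rightarrow> 'm \<times> 'a \<Rightarrow> 'm \<times> 'a \<Rightarrow> 'm \<times> 'a" where
  "oplus M A = (\<lambda>(e, a) (f, b).
     (e \<otimes>\<^bsub>M\<^esub> f,
      res A e (e \<otimes>\<^bsub>M\<^esub> f) a \<otimes>\<^bsub>fib A (e \<otimes>\<^bsub>M\<^esub> f)\<^esub> res A f (e \<otimes>\<^bsub>M\<^esub> f) b))"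

definition zero_at :: "('m, 'a) lmodule \<Rightarrow> 'm \<Rightarrow> 'm \<times> 'a" where
  "zero_at A e = (e, \<one>\<^bsub>fib A e\<^esub>)"

locale lausch_module = inverse_monoid M for M (structure) +
  fixes A :: "('m, 'a) lmodule"
  assumes fib_comm_group: "e \<in> idems M \<Longrightarrow> comm_group (fib A e)"
    and res_hom: "\<lbrakk>e \<in> idems M; f \<in> idems M; nat_le M f e\<rbrakk>
      \<Longrightarrow> res A e f \<in> hom (fib A e) (fib A f)"
    and res_id: "\<lbrakk>e \<in> idems M; a \<in> carrier (fib A e)\<rbrakk> \<Longrightarrow> res A e e a = a"
    and res_comp: "\<lbrakk>e \<in> idems M; f \<in> idems M; g \<in> idems M; nat_le M f e; nat_le M g f;
        a \<in> carrier (fib A e)\<rbrakk> \<Longrightarrow> res A f g (res A e f a) = res A e g a"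
    and act_closed: "\<lbrakk>p \<in> total M A; s \<in> carrier M\<rbrakk> \<Longrightarrow> act A p s \<in> total M A"
    and act_oplus: "\<lbrakk>p \<in> total M A; q \<in> total M A; s \<in> carrier M\<rbrakk>
      \<Longrightarrow> act A (oplus M A p q) s = oplus M A (act A p s) (act A q s)"
    and act_mult: "\<lbrakk>p \<in> total M A; s \<in> carrier M; t \<in> carrier M\<rbrakk>
      \<Longrightarrow> act A p (s \<otimes> t) = act A (act A p s) t"
    and act_idem: "\<lbrakk>p \<in> total M A; e \<in> idems M\<rbrakk> \<Longrightarrow> act A p e = oplus M A p (zero_at A e)"
    and act_zero: "\<lbrakk>e \<in> idems M; s \<in> carrier M\<rbrakk>
      \<Longrightarrow> act A (zero_at A e) s = zero_at A (sinv M s \<otimes> e \<otimes> s)"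

definition total_map :: "('m \<Rightarrow> 'a \<Rightarrow> 'b) \<Rightarrow> 'm \<times> 'a \<Rightarrow> 'm \<times> 'b" where
  "total_map \<phi> = (\<lambda>(e, a). (e, \<phi> e a))"

text \<open>Morphisms of \<open>M\<close>-modules are families \<open>\<phi> e\<close> of group homomorphisms, i.e. they lie over
  the identity of \<open>E(M)\<close>.\<close>

definition lmodule_iso :: "('m, 'c) monoid_scheme \<Rightarrow> ('m, 'a) lmodule \<Rightarrow> ('m, 'b) lmodule \<Rightarrow>
    ('m \<Rightarrow> 'a \<Rightarrow> 'b) \<Rightarrow> bool" where
  "lmodule_iso M A B \<phi> \<longleftrightarrow>
     (\<forall>e\<in>idems M. \<phi> e \<in> iso (fib A e) (fib B e)) \<and>
     (\<forall>e\<in>idems M. \<forall>f\<in>idems M. nat_le M f e \<longrightarrow>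
        (\<forall>a\<in>carrier (fib A e). \<phi> f (res A e f a) = res B e f (\<phi> e a))) \<and>
     (\<forall>p\<in>total M A. \<forall>s\<in>carrier M.
        total_map \<phi> (act A p s) = act B (total_map \<phi> p) s)"

definition lmodule_isomorphic ::
  "('m, 'c) monoid_scheme \<Rightarrow> ('m, 'a) lmodule \<Rightarrow> ('m, 'b) lmodule \<Rightarrow> bool" where
  "lmodule_isomorphic M A B \<longleftrightarrow> (\<exists>\<phi>. lmodule_iso M A B \<phi>)"

definition kernel_lmodule ::
  "('m, 'a) lmodule \<Rightarrow> ('m, 'b) lmodule \<Rightarrow> ('m \<Rightarrow> 'a \<Rightarrow> 'b) \<Rightarrow> ('m, 'a) lmodule" where
  "kernel_lmodule A B \<phi> =
     A\<lparr>fib := \<lambda>e. (fib A e)\<lparr>carrier := kernel (fib A e) (fib B e) (\<phi> e)\<rparr>\<rparr>"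


section \<open>Inverse monoid presentations\<close>

text \<open>\<open>Inl x\<close> is the letter \<open>x\<close> and \<open>Inr x\<close> its formal inverse.\<close>

type_synonym 'x word = "('x + 'x) list"

type_synonym 'x fim_elem = "'x word set"

definition free_monoid :: "'x set \<Rightarrow> 'x word monoid" where
  "free_monoid X = \<lparr>carrier = lists (X <+> X), mult = (@), one = []\<rparr>"

definition word_inv :: "'x word \<Rightarrow> 'x word" where
  "word_inv w = rev (map (case_sum Inr Inl) w)"

text \<open>The free inverse monoid is the quotient of the free monoid by the Wagner congruence.\<close>

definition wagner :: "'x set \<Rightarrow> ('x word \<times> 'x word) set" where
  "wagner X = cong_gen (free_monoid X)
     ({(u @ word_inv u @ u, u) | u. u \<in> carrier (free_monoid X)} \<union>
      {(u @ word_inv u @ v @ word_inv v, v @ word_inv v @ u @ word_inv u) | u v.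
         u \<in> carrier (free_monoid X) \<and> v \<in> carrier (free_monoid X)})"

definition FIM :: "'x set \<Rightarrow> 'x fim_elem monoid" where
  "FIM X = quot_monoid (free_monoid X) (wagner X)"

definition fim_map :: "'x set \<Rightarrow> 'x word \<Rightarrow> 'x fim_elem" where
  "fim_map X w = wagner X `` {w}"

definition pres_cong ::
  "'x set \<Rightarrow> ('x word \<times> 'x word) set \<Rightarrow> ('x fim_elem \<times> 'x fim_elem) set" where
  "pres_cong X R = cong_gen (FIM X) {(fim_map X l, fim_map X r) | l r. (l, r) \<in> R}"

definition pres_monoid ::
  "'x set \<Rightarrow> ('x word \<times> 'x word) set \<Rightarrow> 'x fim_elem set monoid" where
  "pres_monoid X R = quot_monoid (FIM X) (pres_cong X R)"

definition theta ::
  "'x set \<Rightarrow> ('x word \<times> 'x word) set \<Rightarrow> 'x fim_elem \<Rightarrow> 'x fim_elem set" where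
  "theta X R a = pres_cong X R `` {a}"

definition theta_min ::
  "'x set \<Rightarrow> ('x word \<times> 'x word) set \<Rightarrow> ('x fim_elem \<times> 'x fim_elem) set" where
  "theta_min X R = {(a, b). a \<in> carrier (FIM X) \<and> b \<in> carrier (FIM X) \<and>
     (\<exists>e\<in>idems (FIM X). a \<otimes>\<^bsub>FIM X\<^esub> e = b \<otimes>\<^bsub>FIM X\<^esub> e \<and>
        theta X R (sinv (FIM X) a \<otimes>\<^bsub>FIM X\<^esub> a) = theta X R e \<and>
        theta X R e = theta X R (sinv (FIM X) b \<otimes>\<^bsub>FIM X\<^esub> b))}"

definition T_monoid ::
  "'x set \<Rightarrow> ('x word \<times> 'x word) set \<Rightarrow> 'x fim_elem set monoid" where
  "T_monoid X R = quot_monoid (FIM X) (theta_min X R)"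

text \<open>\<open>theta X R\<close> is constant on each class of \<open>theta_min X R\<close>.\<close>

definition psi ::
  "'x set \<Rightarrow> ('x word \<times> 'x word) set \<Rightarrow> 'x fim_elem set \<Rightarrow> 'x fim_elem set" where
  "psi X R C = the_elem (theta X R ` C)"


section \<open>The relation module\<close>

text \<open>The identity of \<open>K\<^sub>e\<close> is the only idempotent that \<open>psi\<close> maps to \<open>e\<close>.\<close>

definition K_group :: "'x set \<Rightarrow> ('x word \<times> 'x word) set \<Rightarrow> 'x fim_elem set \<Rightarrow>
    'x fim_elem set monoid" where
  "K_group X R e = \<lparr>
     carrier = {a \<in> carrier (T_monoid X R). psi X R a = e},
     mult = mult (T_monoid X R),
     one = (THE f. f \<in> idems (T_monoid X R) \<and> psi X R f = e)\<rparr>"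

definition abelianization :: "('a, 'b) monoid_scheme \<Rightarrow> 'a set monoid" where
  "abelianization G = G Mod derived G (carrier G)"

definition ab_class :: "('a, 'b) monoid_scheme \<Rightarrow> 'a \<Rightarrow> 'a set" where
  "ab_class G k = derived G (carrier G) #>\<^bsub>G\<^esub> k"

text \<open>The union runs over all representatives \<open>k\<close> of the class \<open>C\<close> and all preimages \<open>t\<close> of
  \<open>m\<close>. It is again an element of an abelianization only if all these choices give the same
  class.\<close>

definition K_act :: "'x set \<Rightarrow> ('x word \<times> 'x word) set \<Rightarrow>
    'x fim_elem set \<times> 'x fim_elem set set \<Rightarrow> 'x fim_elem set \<Rightarrow>
    'x fim_elem set \<times> 'x fim_elem set set" where
  "K_act X R = (\<lambda>(e, C) m.
     let M = pres_monoid X R; T = T_monoid X R; f = sinv M m \<otimes>\<^bsub>M\<^esub> e \<otimes>\<^bsub>M\<^esub> m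
     in (f, \<Union>k\<in>C. \<Union>t\<in>{t \<in> carrier T. psi X R t = m}.
              ab_class (K_group X R f) (sinv T t \<otimes>\<^bsub>T\<^esub> k \<otimes>\<^bsub>T\<^esub> t)))"

text \<open>In a module, the action of an idempotent \<open>f \<le> e\<close> on \<open>A\<^sub>e\<close> is the map from \<open>A\<^sub>e\<close> to \<open>A\<^sub>f\<close>,
  since \<open>a \<lhd> f = a \<oplus> 0\<^sub>f\<close>. Here and for the chain modules below this determines \<open>res\<close>.\<close>

definition relation_module :: "'x set \<Rightarrow> ('x word \<times> 'x word) set \<Rightarrow>
    ('x fim_elem set, 'x fim_elem set set) lmodule" where
  "relation_module X R = \<lparr>
     fib = (\<lambda>e. abelianization (K_group X R e)),
     res = (\<lambda>e f C. snd (K_act X R (e, C) f)),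
     act = K_act X R\<rparr>"


section \<open>The left Schuetzenberger graph and its homology\<close>

definition gen_img ::
  "'x set \<Rightarrow> ('x word \<times> 'x word) set \<Rightarrow> 'x \<Rightarrow> 'x fim_elem set" where
  "gen_img X R x = theta X R (fim_map X [Inl x])"

definition sch_edges ::
  "'x set \<Rightarrow> ('x word \<times> 'x word) set \<Rightarrow> ('x \<times> 'x fim_elem set) set" where
  "sch_edges X R = (let M = pres_monoid X R in
     {(x, s). x \<in> X \<and> s \<in> carrier M \<and>
        nat_le M (s \<otimes>\<^bsub>M\<^esub> sinv M s) (theta X R (fim_map X [Inr x, Inl x]))})"

definition sch_source :: "'x \<times> 'x fim_elem set \<Rightarrow> 'x fim_elem set" where
  "sch_source = (\<lambda>(x, s). s)"

definition sch_target :: "'x set \<Rightarrow> ('x word \<times> 'x word) set \<Rightarrow>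
    'x \<times> 'x fim_elem set \<Rightarrow> 'x fim_elem set" where
  "sch_target X R = (\<lambda>(x, s). gen_img X R x \<otimes>\<^bsub>pres_monoid X R\<^esub> s)"

definition L_class ::
  "'x set \<Rightarrow> ('x word \<times> 'x word) set \<Rightarrow> 'x fim_elem set \<Rightarrow> 'x fim_elem set set" where
  "L_class X R e = (let M = pres_monoid X R in
     {s \<in> carrier M. sinv M s \<otimes>\<^bsub>M\<^esub> s = e})"

text \<open>The edges of the full subgraph on \<open>L_class X R e\<close>: the target of an edge is always in the
  same \<open>L\<close>-class as its source.\<close>

definition comp_edges :: "'x set \<Rightarrow> ('x word \<times> 'x word) set \<Rightarrow> 'x fim_elem set \<Rightarrow>
    ('x \<times> 'x fim_elem set) set" where
  "comp_edges X R e = {d \<in> sch_edges X R. sch_source d \<in> L_class X R e}"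

definition C0_act :: "'x set \<Rightarrow> ('x word \<times> 'x word) set \<Rightarrow> 'x fim_elem set \<Rightarrow>
    ('x fim_elem set \<Rightarrow>\<^sub>0 int) \<Rightarrow> ('x fim_elem set \<Rightarrow>\<^sub>0 int)" where
  "C0_act X R t = frag_extend (\<lambda>s. frag_of (s \<otimes>\<^bsub>pres_monoid X R\<^esub> t))"

definition C1_act :: "'x set \<Rightarrow> ('x word \<times> 'x word) set \<Rightarrow> 'x fim_elem set \<Rightarrow>
    ('x \<times> 'x fim_elem set \<Rightarrow>\<^sub>0 int) \<Rightarrow> ('x \<times> 'x fim_elem set \<Rightarrow>\<^sub>0 int)" where
  "C1_act X R t = frag_extend (\<lambda>(x, s). frag_of (x, s \<otimes>\<^bsub>pres_monoid X R\<^esub> t))"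

definition C0_module :: "'x set \<Rightarrow> ('x word \<times> 'x word) set \<Rightarrow>
    ('x fim_elem set, 'x fim_elem set \<Rightarrow>\<^sub>0 int) lmodule" where
  "C0_module X R = (let M = pres_monoid X R in \<lparr>
     fib = (\<lambda>e. free_Abelian_group (L_class X R e)),
     res = (\<lambda>e f. C0_act X R f),
     act = (\<lambda>(e, c) t. (sinv M t \<otimes>\<^bsub>M\<^esub> e \<otimes>\<^bsub>M\<^esub> t, C0_act X R t c))\<rparr>)"

definition C1_module :: "'x set \<Rightarrow> ('x word \<times> 'x word) set \<Rightarrow>
    ('x fim_elem set, 'x \<times> 'x fim_elem set \<Rightarrow>\<^sub>0 int) lmodule" where
  "C1_module X R = (let M = pres_monoid X R in \<lparr>
     fib = (\<lambda>e. free_Abelian_group (comp_edges X R e)),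
     res = (\<lambda>e f. C1_act X R f),
     act = (\<lambda>(e, c) t. (sinv M t \<otimes>\<^bsub>M\<^esub> e \<otimes>\<^bsub>M\<^esub> t, C1_act X R t c))\<rparr>)"

definition sch_boundary :: "'x set \<Rightarrow> ('x word \<times> 'x word) set \<Rightarrow>
    ('x \<times> 'x fim_elem set \<Rightarrow>\<^sub>0 int) \<Rightarrow> ('x fim_elem set \<Rightarrow>\<^sub>0 int)" where
  "sch_boundary X R =
     frag_extend (\<lambda>d. frag_of (sch_target X R d) - frag_of (sch_source d))"

definition sch_homology_module :: "'x set \<Rightarrow> ('x word \<times> 'x word) set \<Rightarrow>
    ('x fim_elem set, 'x \<times> 'x fim_elem set \<Rightarrow>\<^sub>0 int) lmodule" where
  "sch_homology_module X R =
     kernel_lmodule (C1_module X R) (C0_module X R) (\<lambda>e. sch_boundary X R)"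

end

theory Submission
  imports Defs
begin

text \<open>A word \<open>w\<close> labels at most one path in the Schuetzenberger graph from a given vertex \<open>s\<close>, and
  sending \<open>w\<close> to the chain of that path is a crossed homomorphism in the style of Fox calculus. On
  the paths that exist, this chain depends only on the image of \<open>w\<close> in \<open>\<T>\<close>: it respects the Wagner
  congruence because the path of \<open>u u\<^sup>-\<^sup>1\<close> runs back along itself, and it respects \<open>\<theta>\<^sub>m\<^sub>i\<^sub>n\<close> because
  idempotents have zero chains. With \<open>s = e\<close> this gives a homomorphism from \<open>K\<^sub>e\<close> to the cycles in the
  component of \<open>e\<close>. Choosing for every vertex \<open>s\<close> a path from \<open>e\<close> to \<open>s\<close> closes up each edge to a
  loop, i.e. to an element of \<open>K\<^sub>e\<close>. This shows that every cycle is the chain of an element of \<open>K\<^sub>e\<close>,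
  and it defines a homomorphism \<open>C\<^sub>1 \<rightarrow> K\<^sub>e\<^sup>a\<^sup>b\<close> which sends the chain of \<open>k\<close> back to the class of \<open>k\<close>,
  so that the kernel is the commutator subgroup. Well-definedness of the action on \<open>\<K>\<close> and its module
  axioms follow from those of \<open>\<H>\<close> through the isomorphism.\<close>

section \<open>Inverse monoids\<close>

text \<open>All elements of \<open>K e\<close> have the same image \<open>e\<close> in M, so a chain
  cannot be read off from M; it is computed on words and has to descend as far as T. The recursion
  is total, but its value is not invariant where the path does not exist: at \<open>s\<close> the
  word for x^-1 x gets the chain (x, s) - (x, x^-1 x s), which vanishes only if x^-1 x fixes
  \<open>s\<close>. Hence \<open>defined_at\<close> accompanies the chains throughout, and the
  arguments rest on two of its properties: it splits over products, and it is stable under right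
  multiplication. Closing up the edges of a path one by one inserts a detour b b^-1 at every
  intermediate vertex, and in an inverse monoid such an idempotent is not the identity. In T an
  idempotent is determined by its image in M, so the detour is absorbed by every element that has
  the same image as b. The same property makes \<open>K e\<close> a group: it contains exactly one
  idempotent.\<close>

lemma idems_closed: "e \<in> idems M \<Longrightarrow> e \<in> carrier M"
  by (simp add: idems_def)

lemma idems_idem: "e \<in> idems M \<Longrightarrow> e \<otimes>\<^bsub>M\<^esub> e = e"
  by (simp add: idems_def)

lemma idemsI: "\<lbrakk>e \<in> carrier M; e \<otimes>\<^bsub>M\<^esub> e = e\<rbrakk> \<Longrightarrow> e \<in> idems M"
  by (simp add: idems_def)

context inverse_monoid
begin

lemma sinv_inverse_pair:
  assumes "a \<in> carrier M"
  shows "sinv M a \<in> carrier M \<and> inverse_pair M a (sinv M a)"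
  unfolding sinv_def by (rule theI'[OF ex1_inverse[OF assms]])

lemma sinv_closed [simp, intro]: "a \<in> carrier M \<Longrightarrow> sinv M a \<in> carrier M"
  using sinv_inverse_pair by blast

lemma mult_sinv_mult: "a \<in> carrier M \<Longrightarrow> a \<otimes> (sinv M a \<otimes> a) = a"
  using sinv_inverse_pair[of a] by (simp add: inverse_pair_def m_assoc)

lemma sinv_mult_sinv: "a \<in> carrier M \<Longrightarrow> sinv M a \<otimes> (a \<otimes> sinv M a) = sinv M a"
  using sinv_inverse_pair[of a] by (simp add: inverse_pair_def m_assoc)

lemma mult_sinv_mult_left:
  "\<lbrakk>a \<in> carrier M; b \<in> carrier M\<rbrakk> \<Longrightarrow> a \<otimes> (sinv M a \<otimes> (a \<otimes> b)) = a \<otimes> b"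
  using mult_sinv_mult[of a] by (simp flip: m_assoc)

lemma sinv_mult_sinv_left:
  "\<lbrakk>a \<in> carrier M; b \<in> carrier M\<rbrakk> \<Longrightarrow> sinv M a \<otimes> (a \<otimes> (sinv M a \<otimes> b)) = sinv M a \<otimes> b"
  using sinv_mult_sinv[of a] by (simp flip: m_assoc)

lemmas sinv_simps = mult_sinv_mult sinv_mult_sinv mult_sinv_mult_left sinv_mult_sinv_left

lemma sinv_equality:
  assumes "a \<in> carrier M" "b \<in> carrier M" "a \<otimes> (b \<otimes> a) = a" "b \<otimes> (a \<otimes> b) = b"
  shows "sinv M a = b"
proof -
  have "inverse_pair M a b"
    using assms by (simp add: inverse_pair_def m_assoc)
  then show ?thesis
    using ex1_inverse[OF assms(1)] sinv_inverse_pair[OF assms(1)] assms(2) by blast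
qed

lemma sinv_sinv [simp]: "a \<in> carrier M \<Longrightarrow> sinv M (sinv M a) = a"
  by (rule sinv_equality) (simp_all add: sinv_simps)

lemma sinv_idem: "e \<in> idems M \<Longrightarrow> sinv M e = e"
  by (rule sinv_equality) (simp_all add: idems_def)

lemma mult_sinv_idem: "a \<in> carrier M \<Longrightarrow> a \<otimes> sinv M a \<in> idems M"
  by (simp add: idems_def m_assoc sinv_simps)

lemma sinv_mult_idem: "a \<in> carrier M \<Longrightarrow> sinv M a \<otimes> a \<in> idems M"
  by (simp add: idems_def m_assoc sinv_simps)

text \<open>If \<open>x\<close> is the inverse of \<open>e f\<close>, then \<open>f x e\<close> is
  an inverse of \<open>e f\<close> as well. Uniqueness gives \<open>x = f x e\<close>, which is
  visibly idempotent, and an idempotent is its own inverse, so \<open>e f = x\<close>.\<close>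

lemma idems_mult [intro]:
  assumes e: "e \<in> idems M" and f: "f \<in> idems M"
  shows "e \<otimes> f \<in> idems M"
proof -
  define x where "x = sinv M (e \<otimes> f)"
  have c: "e \<in> carrier M" "f \<in> carrier M" "x \<in> carrier M"
    using e f by (simp_all add: idems_closed x_def)
  have ee: "e \<otimes> (e \<otimes> y) = e \<otimes> y" and ff: "f \<otimes> (f \<otimes> y) = f \<otimes> y" if "y \<in> carrier M" for y
    using c e f that by (metis idems_idem m_assoc)+
  have a1: "e \<otimes> (f \<otimes> (x \<otimes> (e \<otimes> f))) = e \<otimes> f"
    using c mult_sinv_mult[of "e \<otimes> f"] by (simp add: x_def m_assoc)
  have "x \<otimes> (e \<otimes> (f \<otimes> x)) = x"
    using c sinv_mult_sinv[of "e \<otimes> f"] by (simp add: x_def m_assoc)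
  then have a2: "x \<otimes> (e \<otimes> (f \<otimes> (x \<otimes> y))) = x \<otimes> y" if "y \<in> carrier M" for y
    using c that by (simp flip: m_assoc)
  have "x = f \<otimes> (x \<otimes> e)"
    unfolding x_def by (rule sinv_equality) (use c in \<open>simp_all add: m_assoc ee ff a1 a2 flip: x_def\<close>)
  then have "x \<otimes> x = f \<otimes> (x \<otimes> e) \<otimes> (f \<otimes> (x \<otimes> e))"
    by simp
  also have "\<dots> = f \<otimes> (x \<otimes> e)"
    using c by (simp add: m_assoc a2)
  finally have x: "x \<otimes> x = x"
    using \<open>x = f \<otimes> (x \<otimes> e)\<close> by simp
  have "e \<otimes> f = sinv M x"
    using c by (simp add: x_def)
  also have "\<dots> = x"
    using c x by (intro sinv_idem idemsI)
  finally show ?thesis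
    using c x by (simp add: idemsI)
qed

text \<open>The idempotent \<open>e f\<close> is its own inverse, but \<open>f e\<close> is also an
  inverse of it.\<close>

lemma idems_comm:
  assumes e: "e \<in> idems M" and f: "f \<in> idems M"
  shows "e \<otimes> f = f \<otimes> e"
proof -
  have c: "e \<in> carrier M" "f \<in> carrier M"
    using e f by (simp_all add: idems_closed)
  have ee: "e \<otimes> (e \<otimes> y) = e \<otimes> y" and ff: "f \<otimes> (f \<otimes> y) = f \<otimes> y" if "y \<in> carrier M" for y
    using c e f that by (metis idems_idem m_assoc)+
  have "sinv M (e \<otimes> f) = f \<otimes> e"
    by (rule sinv_equality)
      (use c idems_idem[OF idems_mult[OF e f]] idems_idem[OF idems_mult[OF f e]] in
        \<open>simp_all add: m_assoc ee ff\<close>)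
  then show ?thesis
    using sinv_idem[OF idems_mult[OF e f]] by simp
qed

lemma idems_left_comm:
  "\<lbrakk>e \<in> idems M; f \<in> idems M; a \<in> carrier M\<rbrakk> \<Longrightarrow> e \<otimes> (f \<otimes> a) = f \<otimes> (e \<otimes> a)"
  using idems_comm[of e f] by (metis idems_closed m_assoc)

lemma idems_left_idem: "\<lbrakk>e \<in> idems M; a \<in> carrier M\<rbrakk> \<Longrightarrow> e \<otimes> (e \<otimes> a) = e \<otimes> a"
  by (metis idems_closed idems_idem m_assoc)

lemma sinv_mult:
  assumes "a \<in> carrier M" "b \<in> carrier M"
  shows "sinv M (a \<otimes> b) = sinv M b \<otimes> sinv M a"
proof (rule sinv_equality)
  have *: "(b \<otimes> sinv M b) \<otimes> (sinv M a \<otimes> a) = (sinv M a \<otimes> a) \<otimes> (b \<otimes> sinv M b)"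
    using assms by (intro idems_comm mult_sinv_idem sinv_mult_idem)
  have "a \<otimes> b \<otimes> (sinv M b \<otimes> sinv M a \<otimes> (a \<otimes> b)) =
      a \<otimes> ((b \<otimes> sinv M b) \<otimes> (sinv M a \<otimes> a)) \<otimes> b"
    using assms by (simp add: m_assoc)
  also have "\<dots> = a \<otimes> b"
    unfolding * using assms by (simp add: m_assoc sinv_simps)
  finally show "a \<otimes> b \<otimes> (sinv M b \<otimes> sinv M a \<otimes> (a \<otimes> b)) = a \<otimes> b" .
  have "sinv M b \<otimes> sinv M a \<otimes> (a \<otimes> b \<otimes> (sinv M b \<otimes> sinv M a)) =
      sinv M b \<otimes> ((sinv M a \<otimes> a) \<otimes> (b \<otimes> sinv M b)) \<otimes> sinv M a"
    using assms by (simp add: m_assoc)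
  also have "\<dots> = sinv M b \<otimes> sinv M a"
    unfolding *[symmetric] using assms by (simp add: m_assoc sinv_simps)
  finally show "sinv M b \<otimes> sinv M a \<otimes> (a \<otimes> b \<otimes> (sinv M b \<otimes> sinv M a)) = sinv M b \<otimes> sinv M a" .
qed (use assms in auto)

lemma conj_idem:
  assumes "e \<in> idems M" "a \<in> carrier M"
  shows "sinv M a \<otimes> e \<otimes> a \<in> idems M"
proof (rule idemsI)
  have c: "e \<in> carrier M"
    using assms by (simp add: idems_closed)
  have "sinv M a \<otimes> e \<otimes> a \<otimes> (sinv M a \<otimes> e \<otimes> a) = sinv M a \<otimes> (e \<otimes> ((a \<otimes> sinv M a) \<otimes> (e \<otimes> a)))"
    using assms c by (simp add: m_assoc)
  also have "\<dots> = sinv M a \<otimes> ((a \<otimes> sinv M a) \<otimes> (e \<otimes> (e \<otimes> a)))"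
    using assms c by (subst idems_left_comm) (auto intro: mult_sinv_idem)
  also have "\<dots> = sinv M a \<otimes> e \<otimes> a"
    using assms c by (simp add: m_assoc sinv_simps idems_left_idem)
  finally show "sinv M a \<otimes> e \<otimes> a \<otimes> (sinv M a \<otimes> e \<otimes> a) = sinv M a \<otimes> e \<otimes> a" .
qed (use assms in \<open>auto simp: idems_closed\<close>)

lemma idem_mult_eq_mult_conj:
  assumes "e \<in> idems M" "a \<in> carrier M"
  shows "a \<otimes> (sinv M a \<otimes> e \<otimes> a) = e \<otimes> a"
proof -
  have "a \<otimes> (sinv M a \<otimes> e \<otimes> a) = (a \<otimes> sinv M a) \<otimes> (e \<otimes> a)"
    using assms by (simp add: m_assoc idems_closed)
  also have "\<dots> = e \<otimes> ((a \<otimes> sinv M a) \<otimes> a)"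
    using assms by (intro idems_left_comm mult_sinv_idem)
  finally show ?thesis
    using assms by (simp add: m_assoc sinv_simps idems_closed)
qed

lemma nat_le_idem_iff:
  assumes "e \<in> idems M" "f \<in> idems M"
  shows "nat_le M e f \<longleftrightarrow> f \<otimes> e = e"
proof
  assume "nat_le M e f"
  then obtain g where "g \<in> idems M" "e = g \<otimes> f"
    by (auto simp: nat_le_def)
  then show "f \<otimes> e = e"
    using assms by (metis idems_closed idems_comm idems_left_idem)
next
  assume "f \<otimes> e = e"
  then show "nat_le M e f"
    using assms by (metis idems_closed idems_comm nat_le_def)
qed

lemma nat_le_mult_sinv_iff:
  assumes "s \<in> carrier M" "f \<in> idems M"
  shows "nat_le M (s \<otimes> sinv M s) f \<longleftrightarrow> f \<otimes> s = s"
proof -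
  have "f \<otimes> (s \<otimes> sinv M s) = s \<otimes> sinv M s \<longleftrightarrow> f \<otimes> s = s"
  proof
    have c: "f \<in> carrier M"
      using assms by (simp add: idems_closed)
    assume "f \<otimes> (s \<otimes> sinv M s) = s \<otimes> sinv M s"
    then have "f \<otimes> (s \<otimes> sinv M s) \<otimes> s = s \<otimes> sinv M s \<otimes> s"
      by simp
    then show "f \<otimes> s = s"
      using assms(1) c by (simp add: m_assoc sinv_simps)
  next
    assume "f \<otimes> s = s"
    then show "f \<otimes> (s \<otimes> sinv M s) = s \<otimes> sinv M s"
      using assms by (simp add: idems_closed flip: m_assoc)
  qed
  then show ?thesis
    using assms by (simp add: nat_le_idem_iff mult_sinv_idem)
qed

lemma hom_sinv:
  assumes "inverse_monoid N" "h \<in> hom M N" "a \<in> carrier M"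
  shows "h (sinv M a) = sinv N (h a)"
proof -
  interpret N: inverse_monoid N by fact
  have m: "h (x \<otimes> y) = h x \<otimes>\<^bsub>N\<^esub> h y" and c: "h x \<in> carrier N"
    if "x \<in> carrier M" "y \<in> carrier M" for x y
    using assms(2) that by (auto simp: hom_def)
  have "sinv N (h a) = h (sinv M a)"
  proof (rule N.sinv_equality)
    show "h a \<otimes>\<^bsub>N\<^esub> (h (sinv M a) \<otimes>\<^bsub>N\<^esub> h a) = h a"
      using assms(3) mult_sinv_mult[of a] by (simp flip: m)
    show "h (sinv M a) \<otimes>\<^bsub>N\<^esub> (h a \<otimes>\<^bsub>N\<^esub> h (sinv M a)) = h (sinv M a)"
      using assms(3) sinv_mult_sinv[of a] by (simp flip: m)
  qed (use assms(3) c in auto)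
  then show ?thesis by simp
qed

end

text \<open>Two inverses \<open>b\<close> and \<open>c\<close> of \<open>a\<close> both equal
  \<open>b a c\<close>: commuting \<open>a c\<close> with \<open>a b\<close> gives
  \<open>b = b a c\<close>, and commuting \<open>b a\<close> with \<open>c a\<close> gives
  \<open>b a c = c\<close>.\<close>

lemma inverse_monoidI:
  fixes M (structure)
  assumes "monoid M"
    and inv: "\<And>a. a \<in> carrier M \<Longrightarrow> \<exists>b\<in>carrier M. inverse_pair M a b"
    and comm: "\<And>e f. \<lbrakk>e \<in> idems M; f \<in> idems M\<rbrakk> \<Longrightarrow> e \<otimes> f = f \<otimes> e"
  shows "inverse_monoid M"
proof -
  interpret monoid M by fact
  show ?thesis
  proof
    fix a assume a: "a \<in> carrier M"
    have "b = c" if b: "b \<in> carrier M" "inverse_pair M a b" and c: "c \<in> carrier M" "inverse_pair M a c"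
      for b c
    proof -
      note cl = a b(1) c(1)
      have eq: "a \<otimes> (b \<otimes> a) = a" "b \<otimes> (a \<otimes> b) = b" "a \<otimes> (c \<otimes> a) = a" "c \<otimes> (a \<otimes> c) = c"
        using cl b(2) c(2) by (simp_all add: inverse_pair_def m_assoc)
      have eqb: "a \<otimes> (b \<otimes> (a \<otimes> x)) = a \<otimes> x" and eqc: "a \<otimes> (c \<otimes> (a \<otimes> x)) = a \<otimes> x"
        if "x \<in> carrier M" for x
        using cl that eq(1,3) by (simp_all flip: m_assoc)
      have id: "a \<otimes> b \<in> idems M" "a \<otimes> c \<in> idems M" "b \<otimes> a \<in> idems M" "c \<otimes> a \<in> idems M"
        using cl by (auto intro!: idemsI simp: m_assoc eq eqb eqc)
      have "b = b \<otimes> ((a \<otimes> c) \<otimes> (a \<otimes> b))"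
        using cl by (simp add: m_assoc eq eqc)
      also have "\<dots> = ((b \<otimes> a) \<otimes> (c \<otimes> a)) \<otimes> c"
        unfolding comm[OF id(2,1)] using cl by (simp add: m_assoc eq eqb)
      also have "\<dots> = c"
        unfolding comm[OF id(3,4)] using cl by (simp add: m_assoc eq eqb)
      finally show ?thesis .
    qed
    then show "\<exists>!b. b \<in> carrier M \<and> inverse_pair M a b"
      using inv[OF a] by blast
  qed
qed


section \<open>Congruences and quotients\<close>

lemma congruence_mult:
  "\<lbrakk>congruence S r; (a, b) \<in> r; (c, d) \<in> r\<rbrakk> \<Longrightarrow> (a \<otimes>\<^bsub>S\<^esub> c, b \<otimes>\<^bsub>S\<^esub> d) \<in> r"
  by (auto simp: congruence_def)

lemma congruence_equiv: "congruence S r \<Longrightarrow> equiv (carrier S) r"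
  by (simp add: congruence_def)

lemma congruence_class_eq_iff:
  "\<lbrakk>congruence S r; a \<in> carrier S; b \<in> carrier S\<rbrakk> \<Longrightarrow> r `` {a} = r `` {b} \<longleftrightarrow> (a, b) \<in> r"
  by (meson congruence_equiv eq_equiv_class_iff)

lemma cong_gen_upper: "R \<subseteq> cong_gen S R"
  by (auto simp: cong_gen_def)

lemma cong_gen_least: "\<lbrakk>congruence S r; R \<subseteq> r\<rbrakk> \<Longrightarrow> cong_gen S R \<subseteq> r"
  by (auto simp: cong_gen_def)

lemma congruence_cong_gen:
  assumes "monoid S" "R \<subseteq> carrier S \<times> carrier S"
  shows "congruence S (cong_gen S R)"
proof -
  interpret monoid S by fact
  \<comment> \<open>The full relation is a congruence containing \<open>R\<close>; it keeps the
    intersection in \<open>cong_gen\<close> from running over an empty family.\<close>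
  have "equiv (carrier S) (carrier S \<times> carrier S)"
    by (auto simp: equiv_def refl_on_def sym_def trans_def)
  then have full: "congruence S (carrier S \<times> carrier S)"
    by (auto simp: congruence_def)
  have "equiv (carrier S) (cong_gen S R)"
  proof (rule equivI)
    show "cong_gen S R \<subseteq> carrier S \<times> carrier S"
      using cong_gen_least[OF full assms(2)] .
    show "refl_on (carrier S) (cong_gen S R)"
      unfolding cong_gen_def by (auto simp: congruence_def equiv_def refl_on_def)
    show "sym (cong_gen S R)"
      unfolding cong_gen_def
      by (rule symI) (blast dest: congruence_equiv equivE symD)
    show "trans (cong_gen S R)"
    proof (rule transI)
      fix a b c assume "(a, b) \<in> cong_gen S R" "(b, c) \<in> cong_gen S R"
      then have "(a, c) \<in> r" if "congruence S r" "R \<subseteq> r" for r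
        using that congruence_equiv[OF that(1)] cong_gen_least[OF that]
        by (metis equivE subsetD transD)
      then show "(a, c) \<in> cong_gen S R"
        by (auto simp: cong_gen_def)
    qed
  qed
  then show ?thesis
    by (auto simp: congruence_def cong_gen_def)
qed

lemma quot_monoid_carrier: "carrier (quot_monoid S r) = carrier S // r"
  by (simp add: quot_monoid_def)

lemma quot_monoid_one: "\<one>\<^bsub>quot_monoid S r\<^esub> = r `` {\<one>\<^bsub>S\<^esub>}"
  by (simp add: quot_monoid_def)

lemma quot_monoid_mult:
  assumes "congruence S r" "a \<in> carrier S" "b \<in> carrier S"
  shows "r `` {a} \<otimes>\<^bsub>quot_monoid S r\<^esub> r `` {b} = r `` {a \<otimes>\<^bsub>S\<^esub> b}"
proof -
  have eq: "equiv (carrier S) r"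
    using assms(1) by (rule congruence_equiv)
  have "r `` {x \<otimes>\<^bsub>S\<^esub> y} = r `` {a \<otimes>\<^bsub>S\<^esub> b}" if "(a, x) \<in> r" "(b, y) \<in> r" for x y
    using congruence_mult[OF assms(1) that] equiv_class_eq[OF eq] by blast
  then have "(\<Union>x\<in>r `` {a}. \<Union>y\<in>r `` {b}. r `` {x \<otimes>\<^bsub>S\<^esub> y}) = (\<Union>x\<in>r `` {a}. \<Union>y\<in>r `` {b}. r `` {a \<otimes>\<^bsub>S\<^esub> b})"
    by (intro SUP_cong refl) auto
  moreover have "a \<in> r `` {a}" "b \<in> r `` {b}"
    using eq assms by (auto simp: equiv_def refl_on_def)
  then have "r `` {a} \<noteq> {}" "r `` {b} \<noteq> {}"
    by blast+
  ultimately show ?thesis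
    by (simp add: quot_monoid_def)
qed

lemma quot_monoid_hom: 
  assumes "congruence S r"
  shows "(\<lambda>a. r `` {a}) \<in> hom S (quot_monoid S r)"
  by (rule homI) (auto simp: quot_monoid_carrier quot_monoid_mult[OF assms] intro: quotientI)

lemma quot_monoid_elem:
  assumes "A \<in> carrier (quot_monoid S r)"
  obtains a where "a \<in> carrier S" "A = r `` {a}"
  using assms by (auto simp: quot_monoid_carrier elim: quotientE)

lemma quot_monoid_class: "a \<in> carrier S \<Longrightarrow> r `` {a} \<in> carrier (quot_monoid S r)"
  by (auto simp: quot_monoid_carrier intro: quotientI)

lemma monoid_quot_monoid:
  assumes "monoid S" "congruence S r"
  shows "monoid (quot_monoid S r)"
proof -
  interpret monoid S by fact
  note mult = quot_monoid_mult[OF assms(2)]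
  show ?thesis
  proof
    fix A B C
    assume "A \<in> carrier (quot_monoid S r)" "B \<in> carrier (quot_monoid S r)"
    then obtain a b where ab: "a \<in> carrier S" "A = r `` {a}" "b \<in> carrier S" "B = r `` {b}"
      by (metis quot_monoid_elem)
    then show "A \<otimes>\<^bsub>quot_monoid S r\<^esub> B \<in> carrier (quot_monoid S r)"
      by (auto simp: mult intro: quot_monoid_class)
    assume "C \<in> carrier (quot_monoid S r)"
    then obtain c where "c \<in> carrier S" "C = r `` {c}"
      by (metis quot_monoid_elem)
    with ab show "A \<otimes>\<^bsub>quot_monoid S r\<^esub> B \<otimes>\<^bsub>quot_monoid S r\<^esub> C =
        A \<otimes>\<^bsub>quot_monoid S r\<^esub> (B \<otimes>\<^bsub>quot_monoid S r\<^esub> C)"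
      by (simp add: mult m_assoc)
  next
    show "\<one>\<^bsub>quot_monoid S r\<^esub> \<in> carrier (quot_monoid S r)"
      by (auto simp: quot_monoid_one intro: quot_monoid_class)
  next
    fix A assume "A \<in> carrier (quot_monoid S r)"
    then obtain a where "a \<in> carrier S" "A = r `` {a}"
      by (metis quot_monoid_elem)
    then show "\<one>\<^bsub>quot_monoid S r\<^esub> \<otimes>\<^bsub>quot_monoid S r\<^esub> A = A"
      "A \<otimes>\<^bsub>quot_monoid S r\<^esub> \<one>\<^bsub>quot_monoid S r\<^esub> = A"
      by (simp_all add: mult quot_monoid_one)
  qed
qed

text \<open>Lallement's lemma: if \<open>a\<^sup>2\<close> is congruent to \<open>a\<close>, then \<open>a (a\<^sup>2)\<^sup>-\<^sup>1 a\<close> is an idempotent congruent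
  to \<open>a\<close>.\<close>

lemma quot_monoid_idem_lift:
  assumes "inverse_monoid S" "congruence S r" "E \<in> idems (quot_monoid S r)"
  obtains e where "e \<in> idems S" "E = r `` {e}"
proof -
  interpret inverse_monoid S by fact
  obtain a where a: "a \<in> carrier S" "E = r `` {a}"
    using assms(3) by (metis quot_monoid_elem idems_closed)
  have "r `` {a \<otimes>\<^bsub>S\<^esub> a} = r `` {a}"
    using idems_idem[OF assms(3)] a by (simp add: quot_monoid_mult[OF assms(2)])
  then have aa: "(a, a \<otimes>\<^bsub>S\<^esub> a) \<in> r"
    using a congruence_class_eq_iff[OF assms(2)] by blast
  define x where "x = sinv S (a \<otimes>\<^bsub>S\<^esub> a)"
  define e where "e = a \<otimes>\<^bsub>S\<^esub> x \<otimes>\<^bsub>S\<^esub> a"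
  have x: "x \<in> carrier S"
    using a by (simp add: x_def)
  have refl: "(x, x) \<in> r"
    using x congruence_equiv[OF assms(2)] by (auto simp: equiv_def refl_on_def)
  have "x \<otimes>\<^bsub>S\<^esub> (a \<otimes>\<^bsub>S\<^esub> (a \<otimes>\<^bsub>S\<^esub> x)) = x"
    using sinv_mult_sinv[of "a \<otimes>\<^bsub>S\<^esub> a"] a(1) x by (simp add: m_assoc flip: x_def)
  then have "a \<otimes>\<^bsub>S\<^esub> (x \<otimes>\<^bsub>S\<^esub> (a \<otimes>\<^bsub>S\<^esub> (a \<otimes>\<^bsub>S\<^esub> x))) \<otimes>\<^bsub>S\<^esub> a = a \<otimes>\<^bsub>S\<^esub> x \<otimes>\<^bsub>S\<^esub> a"
    by simp
  then have "e \<otimes>\<^bsub>S\<^esub> e = e"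
    using a(1) x by (simp add: e_def m_assoc)
  then have e: "e \<in> idems S"
    using a(1) x by (simp add: e_def idemsI)
  have "a \<otimes>\<^bsub>S\<^esub> a \<otimes>\<^bsub>S\<^esub> x \<otimes>\<^bsub>S\<^esub> (a \<otimes>\<^bsub>S\<^esub> a) = a \<otimes>\<^bsub>S\<^esub> a"
    using mult_sinv_mult[of "a \<otimes>\<^bsub>S\<^esub> a"] a(1) x by (simp add: m_assoc flip: x_def)
  moreover have "(e, a \<otimes>\<^bsub>S\<^esub> a \<otimes>\<^bsub>S\<^esub> x \<otimes>\<^bsub>S\<^esub> (a \<otimes>\<^bsub>S\<^esub> a)) \<in> r"
    unfolding e_def by (intro congruence_mult[OF assms(2)] aa refl)
  ultimately have "r `` {e} = r `` {a}"
    using aa congruence_class_eq_iff[OF assms(2)] a(1) idems_closed[OF e]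
    by (metis m_closed)
  with e a that show thesis by simp
qed

text \<open>Commutation of idempotents passes to the quotient because every idempotent class
  contains an idempotent of \<open>S\<close>.\<close>

lemma inverse_monoid_quot_monoid:
  assumes "inverse_monoid S" "congruence S r"
  shows "inverse_monoid (quot_monoid S r)"
proof -
  interpret inverse_monoid S by fact
  note mult = quot_monoid_mult[OF assms(2)]
  show ?thesis
  proof (rule inverse_monoidI)
    show "monoid (quot_monoid S r)"
      using monoid_quot_monoid assms(2) monoid_axioms by blast
  next
    fix A assume "A \<in> carrier (quot_monoid S r)"
    then obtain a where a: "a \<in> carrier S" "A = r `` {a}"
      by (metis quot_monoid_elem)
    then have "inverse_pair (quot_monoid S r) A (r `` {sinv S a})"
      by (simp add: inverse_pair_def mult m_assoc sinv_simps)
    then show "\<exists>B\<in>carrier (quot_monoid S r). inverse_pair (quot_monoid S r) A B"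
      using quot_monoid_class[OF sinv_closed[OF a(1)]] by blast
  next
    fix E F assume "E \<in> idems (quot_monoid S r)" "F \<in> idems (quot_monoid S r)"
    then obtain e f where "e \<in> idems S" "E = r `` {e}" "f \<in> idems S" "F = r `` {f}"
      using quot_monoid_idem_lift[OF assms, of E] quot_monoid_idem_lift[OF assms, of F] by metis
    then show "E \<otimes>\<^bsub>quot_monoid S r\<^esub> F = F \<otimes>\<^bsub>quot_monoid S r\<^esub> E"
      using idems_comm[of e f] by (simp add: mult idems_closed)
  qed
qed

text \<open>Every idempotent turns out to be a product of two elements of the commuting set \<open>P\<close>.\<close>

lemma inverse_monoidI_commuting:
  fixes S (structure)
  assumes "monoid S"
    and inv: "\<And>a. a \<in> carrier S \<Longrightarrow> \<exists>b\<in>carrier S. inverse_pair S a b \<and> a \<otimes> b \<in> P \<and> b \<otimes> a \<in> P"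
    and P: "P \<subseteq> carrier S" and comm: "\<And>p q. \<lbrakk>p \<in> P; q \<in> P\<rbrakk> \<Longrightarrow> p \<otimes> q = q \<otimes> p"
  shows "inverse_monoid S"
proof (rule inverse_monoidI)
  interpret monoid S by fact
  have prod: "\<exists>p\<in>P. \<exists>q\<in>P. e = p \<otimes> q" if "e \<in> idems S" for e
  proof -
    have e: "e \<in> carrier S" "e \<otimes> e = e"
      using that by (auto simp: idems_def)
    obtain x where x: "x \<in> carrier S" "inverse_pair S e x" "e \<otimes> x \<in> P" "x \<otimes> e \<in> P"
      using inv[OF e(1)] by blast
    have exe: "e \<otimes> (x \<otimes> e) = e" "x \<otimes> (e \<otimes> x) = x"
      using e(1) x(1,2) by (simp_all add: inverse_pair_def m_assoc)
    have l: "e \<otimes> (x \<otimes> (e \<otimes> y)) = e \<otimes> y" "x \<otimes> (e \<otimes> (x \<otimes> y)) = x \<otimes> y" "e \<otimes> (e \<otimes> y) = e \<otimes> y"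
      if "y \<in> carrier S" for y
      using e x(1) exe that by (simp_all flip: m_assoc)
    have swap: "(e \<otimes> x) \<otimes> (x \<otimes> e) = (x \<otimes> e) \<otimes> (e \<otimes> x)"
      using x by (intro comm)
    \<comment> \<open>The inverse \<open>x\<close> of \<open>e\<close> is idempotent too, so that
      \<open>e = e x e = (e x) (x e)\<close> is the required product of two elements of
      \<open>P\<close>.\<close>
    have "x \<otimes> x = (x \<otimes> e) \<otimes> ((e \<otimes> x) \<otimes> (x \<otimes> e)) \<otimes> (e \<otimes> x)"
      using e x(1) by (simp add: m_assoc l exe)
    also have "\<dots> = x"
      unfolding swap using e x(1) by (simp add: m_assoc l exe)
    finally have "x \<otimes> x = x" .
    then have "x \<otimes> (x \<otimes> e) = x \<otimes> e"
      using e x(1) by (simp flip: m_assoc)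
    then have "e = (e \<otimes> x) \<otimes> (x \<otimes> e)"
      using e x(1) by (simp add: m_assoc exe)
    then show ?thesis
      using x by blast
  qed
  have comm3: "p \<otimes> (q \<otimes> a) = q \<otimes> (p \<otimes> a)" if "p \<in> P" "q \<in> P" "a \<in> carrier S" for p q a
    using comm[OF that(1,2)] P that by (metis m_assoc subsetD)
  fix e f assume "e \<in> idems S" "f \<in> idems S"
  then obtain p q p' q' where *: "p \<in> P" "q \<in> P" "e = p \<otimes> q" "p' \<in> P" "q' \<in> P" "f = p' \<otimes> q'"
    using prod by metis
  then have "p \<in> carrier S" "q \<in> carrier S" "p' \<in> carrier S" "q' \<in> carrier S"
    using P by auto
  with * show "e \<otimes> f = f \<otimes> e"
    by (simp add: m_assoc comm comm3)
qed (use assms in blast)+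


section \<open>The free inverse monoid\<close>

lemma monoid_free_monoid: "monoid (free_monoid X)"
  by (rule monoidI) (auto simp: free_monoid_def)

lemma free_monoid_simps:
  "u \<otimes>\<^bsub>free_monoid X\<^esub> v = u @ v" "\<one>\<^bsub>free_monoid X\<^esub> = []"
  by (simp_all add: free_monoid_def)

lemma free_monoid_carrier_simps [simp]:
  "[] \<in> carrier (free_monoid X)"
  "a # w \<in> carrier (free_monoid X) \<longleftrightarrow> a \<in> X <+> X \<and> w \<in> carrier (free_monoid X)"
  "u @ v \<in> carrier (free_monoid X) \<longleftrightarrow> u \<in> carrier (free_monoid X) \<and> v \<in> carrier (free_monoid X)"
  by (auto simp: free_monoid_def)

lemma Plus_simps [simp]: "Inl x \<in> A <+> B \<longleftrightarrow> x \<in> A" "Inr y \<in> A <+> B \<longleftrightarrow> y \<in> B"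
  by auto

lemma word_inv_Nil [simp]: "word_inv [] = []"
  by (simp add: word_inv_def)

lemma word_inv_append [simp]: "word_inv (u @ v) = word_inv v @ word_inv u"
  by (simp add: word_inv_def)

lemma word_inv_word_inv [simp]: "word_inv (word_inv w) = w"
  by (induction w) (auto simp: word_inv_def split: sum.split)

lemma word_inv_closed [simp]: "w \<in> carrier (free_monoid X) \<Longrightarrow> word_inv w \<in> carrier (free_monoid X)"
  by (induction w) (auto simp: word_inv_def)

lemma congruence_wagner: "congruence (free_monoid X) (wagner X)"
  unfolding wagner_def by (rule congruence_cong_gen[OF monoid_free_monoid]) auto

lemma fim_map_closed [simp]: "w \<in> carrier (free_monoid X) \<Longrightarrow> fim_map X w \<in> carrier (FIM X)"
  unfolding fim_map_def FIM_def by (rule quot_monoid_class)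

lemma fim_map_append:
  "\<lbrakk>u \<in> carrier (free_monoid X); v \<in> carrier (free_monoid X)\<rbrakk> \<Longrightarrow> fim_map X (u @ v) = fim_map X u \<otimes>\<^bsub>FIM X\<^esub> fim_map X v"
  unfolding fim_map_def FIM_def
  by (subst quot_monoid_mult[OF congruence_wagner]) (simp_all add: free_monoid_simps)

lemma fim_map_eq_iff:
  "\<lbrakk>u \<in> carrier (free_monoid X); v \<in> carrier (free_monoid X)\<rbrakk> \<Longrightarrow> fim_map X u = fim_map X v \<longleftrightarrow> (u, v) \<in> wagner X"
  unfolding fim_map_def
  by (rule congruence_class_eq_iff[OF congruence_wagner]) (simp_all add: free_monoid_simps)

lemma fim_map_surj:
  assumes "a \<in> carrier (FIM X)"
  obtains w where "w \<in> carrier (free_monoid X)" "a = fim_map X w"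
  using assms unfolding FIM_def fim_map_def
  by (metis quot_monoid_elem)

lemma fim_map_inverse_pair:
  assumes "w \<in> carrier (free_monoid X)"
  shows "inverse_pair (FIM X) (fim_map X w) (fim_map X (word_inv w))"
proof -
  have "(u @ word_inv u @ u, u) \<in> wagner X" if "u \<in> carrier (free_monoid X)" for u
    using that unfolding wagner_def by (intro subsetD[OF cong_gen_upper]) auto
  from this[OF assms] this[OF word_inv_closed[OF assms]] show ?thesis
    using assms by (simp add: inverse_pair_def fim_map_eq_iff flip: fim_map_append)
qed

text \<open>The Wagner relations make only the elements u u^-1 commute and say nothing directly
  about other idempotents. Therefore the criterion with a commuting set is used; a^-1 a belongs to
  that set because u may be taken to be a formal inverse.\<close>

lemma inverse_monoid_FIM: "inverse_monoid (FIM X)"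
proof (rule inverse_monoidI_commuting)
  let ?P = "{fim_map X (u @ word_inv u) | u. u \<in> carrier (free_monoid X)}"
  show "monoid (FIM X)"
    unfolding FIM_def by (intro monoid_quot_monoid monoid_free_monoid congruence_wagner)
  show "?P \<subseteq> carrier (FIM X)"
    by auto
  show "\<exists>b\<in>carrier (FIM X). inverse_pair (FIM X) a b \<and> a \<otimes>\<^bsub>FIM X\<^esub> b \<in> ?P \<and> b \<otimes>\<^bsub>FIM X\<^esub> a \<in> ?P"
    if a: "a \<in> carrier (FIM X)" for a
  proof -
    obtain w where w: "w \<in> carrier (free_monoid X)" "a = fim_map X w"
      using a by (rule fim_map_surj)
    have "a \<otimes>\<^bsub>FIM X\<^esub> fim_map X (word_inv w) = fim_map X (w @ word_inv w)"
      "fim_map X (word_inv w) \<otimes>\<^bsub>FIM X\<^esub> a = fim_map X (word_inv w @ word_inv (word_inv w))"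
      using w by (simp_all flip: fim_map_append)
    moreover have "inverse_pair (FIM X) a (fim_map X (word_inv w))"
      using w fim_map_inverse_pair by blast
    ultimately show ?thesis
      using w(1) word_inv_closed[OF w(1)] by (blast intro: fim_map_closed)
  qed
  show "p \<otimes>\<^bsub>FIM X\<^esub> q = q \<otimes>\<^bsub>FIM X\<^esub> p" if pq: "p \<in> ?P" "q \<in> ?P" for p q
  proof -
    obtain u v where uv: "u \<in> carrier (free_monoid X)" "p = fim_map X (u @ word_inv u)"
      "v \<in> carrier (free_monoid X)" "q = fim_map X (v @ word_inv v)"
      using pq by blast
    have "(u @ word_inv u @ v @ word_inv v, v @ word_inv v @ u @ word_inv u) \<in> wagner X"
      using uv unfolding wagner_def by (intro subsetD[OF cong_gen_upper]) auto
    then show ?thesis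
      using uv by (simp add: fim_map_eq_iff flip: fim_map_append)
  qed
qed

lemma fim_map_word_inv:
  assumes "w \<in> carrier (free_monoid X)"
  shows "fim_map X (word_inv w) = sinv (FIM X) (fim_map X w)"
proof -
  interpret F: inverse_monoid "FIM X" by (rule inverse_monoid_FIM)
  show ?thesis
    using fim_map_inverse_pair[OF assms] assms
    by (intro F.sinv_equality[symmetric]) (simp_all add: inverse_pair_def F.m_assoc)
qed


section \<open>The factorisation of the presentation map\<close>

text \<open>The least congruence that agrees on idempotents with the kernel of the homomorphism
  \<open>h\<close>. Stating it for an arbitrary inverse monoid keeps words out of the proof that it
  is a congruence.\<close>

definition min_cong :: "('a, 'c) monoid_scheme \<Rightarrow> ('a \<Rightarrow> 'b) \<Rightarrow> ('a \<times> 'a) set" where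
  "min_cong S h = {(a, b). a \<in> carrier S \<and> b \<in> carrier S \<and>
     (\<exists>e\<in>idems S. a \<otimes>\<^bsub>S\<^esub> e = b \<otimes>\<^bsub>S\<^esub> e \<and> h (sinv S a \<otimes>\<^bsub>S\<^esub> a) = h e \<and> h e = h (sinv S b \<otimes>\<^bsub>S\<^esub> b))}"

lemma theta_min_eq: "theta_min X R = min_cong (FIM X) (theta X R)"
  by (simp add: theta_min_def min_cong_def)

context inverse_monoid
begin

context
  fixes N and h
  assumes N: "inverse_monoid N" and h: "h \<in> hom M N"
begin

interpretation N: inverse_monoid N by (rule N)

lemma h_mult: "\<lbrakk>a \<in> carrier M; b \<in> carrier M\<rbrakk> \<Longrightarrow> h (a \<otimes> b) = h a \<otimes>\<^bsub>N\<^esub> h b"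
  using h by (auto simp: hom_def)

lemma h_mult_idem:
  assumes "a \<in> carrier M" "e \<in> idems M" "h (sinv M a \<otimes> a) = h e"
  shows "h (a \<otimes> e) = h a"
proof -
  have "h (a \<otimes> e) = h (a \<otimes> (sinv M a \<otimes> a))"
    using assms by (simp add: h_mult idems_closed)
  then show ?thesis
    using assms by (simp add: sinv_simps)
qed

lemma min_cong_imp_eq: "(a, b) \<in> min_cong M h \<Longrightarrow> h a = h b"
  unfolding min_cong_def by clarsimp (metis h_mult_idem)

text \<open>The product \<open>e f\<close> is a common witness. This is the source of the fact that
  \<open>psi\<close> separates idempotents.\<close>

lemma min_cong_idems:
  assumes "e \<in> idems M" "f \<in> idems M" "h e = h f"
  shows "(e, f) \<in> min_cong M h"
proof -
  have "e \<otimes> (e \<otimes> f) = f \<otimes> (e \<otimes> f)"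
    using assms by (metis idems_closed idems_comm idems_left_idem)
  moreover have "h (e \<otimes> f) = h (f \<otimes> f)"
    using assms by (simp add: h_mult idems_closed)
  ultimately show ?thesis
    using assms unfolding min_cong_def
    by (auto simp: sinv_idem idems_idem idems_closed intro!: bexI[of _ "e \<otimes> f"])
qed

text \<open>The witnesses are \<open>e f\<close> for transitivity, the conjugate of \<open>e\<close>
  by \<open>c\<close> for right multiplication, and \<open>e g\<close> with g = (ca)^-1 ca for left
  multiplication. In the last case \<open>e\<close> alone would equalise \<open>c a\<close> and
  \<open>c b\<close>, but its image may lie strictly above that of \<open>g\<close>.\<close>

lemma congruence_min_cong: "congruence M (min_cong M h)"
proof -
  have tr: "(a, c) \<in> min_cong M h" if ab: "(a, b) \<in> min_cong M h" and bc: "(b, c) \<in> min_cong M h" for a b c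
  proof -
    obtain e where e: "e \<in> idems M" "a \<otimes> e = b \<otimes> e" "h (sinv M a \<otimes> a) = h e" "h e = h (sinv M b \<otimes> b)"
      using ab by (auto simp: min_cong_def)
    obtain f where f: "f \<in> idems M" "b \<otimes> f = c \<otimes> f" "h (sinv M b \<otimes> b) = h f" "h f = h (sinv M c \<otimes> c)"
      using bc by (auto simp: min_cong_def)
    have cl: "a \<in> carrier M" "b \<in> carrier M" "c \<in> carrier M" "e \<in> carrier M" "f \<in> carrier M"
      using ab bc e(1) f(1) by (auto simp: min_cong_def idems_closed)
    have "a \<otimes> (e \<otimes> f) = b \<otimes> (e \<otimes> f)"
      using cl e(2) by (simp flip: m_assoc)
    also have "\<dots> = b \<otimes> f \<otimes> e"
      using cl idems_comm[OF e(1) f(1)] by (simp add: m_assoc)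
    also have "\<dots> = c \<otimes> (e \<otimes> f)"
      using cl f(2) idems_comm[OF e(1) f(1)] by (simp add: m_assoc)
    finally have "a \<otimes> (e \<otimes> f) = c \<otimes> (e \<otimes> f)" .
    moreover have "h (e \<otimes> f) = h (f \<otimes> f)"
      using cl e f by (simp add: h_mult)
    ultimately show ?thesis
      using cl e f by (auto simp: min_cong_def idems_idem intro!: bexI[of _ "e \<otimes> f"])
  qed
  have eq: "equiv (carrier M) (min_cong M h)"
  proof (rule equivI)
    show "min_cong M h \<subseteq> carrier M \<times> carrier M"
      by (auto simp: min_cong_def)
    show "refl_on (carrier M) (min_cong M h)"
      by (rule refl_onI) (auto simp: min_cong_def intro: sinv_mult_idem)
    show "sym (min_cong M h)"
      by (rule symI) (auto simp: min_cong_def intro: bexI[rotated])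
    show "trans (min_cong M h)"
      by (rule transI) (rule tr)
  qed
  have right: "(a \<otimes> c, b \<otimes> c) \<in> min_cong M h" if ab: "(a, b) \<in> min_cong M h" and c: "c \<in> carrier M" for a b c
  proof -
    obtain e where e: "e \<in> idems M" "a \<otimes> e = b \<otimes> e" "h (sinv M a \<otimes> a) = h e" "h e = h (sinv M b \<otimes> b)"
      using ab by (auto simp: min_cong_def)
    have cl: "a \<in> carrier M" "b \<in> carrier M" "e \<in> carrier M"
      using ab e(1) by (auto simp: min_cong_def idems_closed)
    have "a \<otimes> c \<otimes> (sinv M c \<otimes> e \<otimes> c) = b \<otimes> c \<otimes> (sinv M c \<otimes> e \<otimes> c)"
      using cl c e(1,2) by (simp add: m_assoc[of a c] m_assoc[of b c] idem_mult_eq_mult_conj)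
        (simp flip: m_assoc)
    moreover have "h (sinv M (x \<otimes> c) \<otimes> (x \<otimes> c)) = h (sinv M c \<otimes> e \<otimes> c)"
      if "x \<in> carrier M" "h (sinv M x \<otimes> x) = h e" for x
    proof -
      have "h (sinv M (x \<otimes> c) \<otimes> (x \<otimes> c)) = h (sinv M c \<otimes> (sinv M x \<otimes> x) \<otimes> c)"
        using that c by (simp add: sinv_mult m_assoc)
      also have "\<dots> = h (sinv M c) \<otimes>\<^bsub>N\<^esub> h (sinv M x \<otimes> x) \<otimes>\<^bsub>N\<^esub> h c"
        using that(1) c by (simp add: h_mult)
      also have "\<dots> = h (sinv M c \<otimes> e \<otimes> c)"
        using that c cl by (simp add: h_mult)
      finally show ?thesis .
    qed
    ultimately show ?thesis
      using cl c e by (auto simp: min_cong_def intro!: bexI[of _ "sinv M c \<otimes> e \<otimes> c"] conj_idem)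
  qed
  have left: "(c \<otimes> a, c \<otimes> b) \<in> min_cong M h" if ab: "(a, b) \<in> min_cong M h" and c: "c \<in> carrier M" for a b c
  proof -
    obtain e where e: "e \<in> idems M" "a \<otimes> e = b \<otimes> e" "h (sinv M a \<otimes> a) = h e" "h e = h (sinv M b \<otimes> b)"
      using ab by (auto simp: min_cong_def)
    have cl: "a \<in> carrier M" "b \<in> carrier M" "e \<in> carrier M"
      using ab e(1) by (auto simp: min_cong_def idems_closed)
    define g where "g = sinv M (c \<otimes> a) \<otimes> (c \<otimes> a)"
    have g: "g \<in> idems M"
      using cl c by (simp add: g_def sinv_mult_idem)
    have "c \<otimes> (a \<otimes> e) \<otimes> g = c \<otimes> (b \<otimes> e) \<otimes> g"
      by (simp only: e(2))
    then have "c \<otimes> a \<otimes> (e \<otimes> g) = c \<otimes> b \<otimes> (e \<otimes> g)"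
      using cl c idems_closed[OF g] by (simp add: m_assoc)
    moreover have "h (e \<otimes> g) = h ((sinv M a \<otimes> a) \<otimes> g)"
      using cl e idems_closed[OF g] by (simp add: h_mult)
    then have "h (e \<otimes> g) = h g"
      using cl c by (simp add: g_def sinv_mult m_assoc sinv_simps)
    moreover have "h (sinv M (c \<otimes> b) \<otimes> (c \<otimes> b)) = h g"
      using cl c min_cong_imp_eq[OF ab] by (simp add: g_def h_mult hom_sinv[OF N h])
    ultimately show ?thesis
      using cl c e g unfolding min_cong_def by (auto simp: g_def[symmetric] intro!: bexI[of _ "e \<otimes> g"])
  qed
  have "(a \<otimes> c, b \<otimes> d) \<in> min_cong M h" if ab: "(a, b) \<in> min_cong M h" and cd: "(c, d) \<in> min_cong M h"
    for a b c d
  proof (rule tr)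
    show "(a \<otimes> c, b \<otimes> c) \<in> min_cong M h"
      using ab cd by (intro right) (simp_all add: min_cong_def)
    show "(b \<otimes> c, b \<otimes> d) \<in> min_cong M h"
      using ab cd by (intro left) (simp_all add: min_cong_def)
  qed
  with eq show ?thesis
    by (simp add: congruence_def)
qed

end

end

text \<open>Left multiplication by \<open>m\<close> as a partial injection: by \<open>nat_le_mult_sinv_iff\<close> this says
  \<open>s s\<^sup>-\<^sup>1 \<le> m\<^sup>-\<^sup>1 m\<close>.\<close>

definition defined_at :: "('a, 'b) monoid_scheme \<Rightarrow> 'a \<Rightarrow> 'a \<Rightarrow> bool" where
  "defined_at M m s \<longleftrightarrow> s \<in> carrier M \<and> sinv M m \<otimes>\<^bsub>M\<^esub> (m \<otimes>\<^bsub>M\<^esub> s) = s"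

context inverse_monoid
begin

text \<open>Lets an argument about a path recurse along its word. From left to right,
  \<open>s\<close> lies in the range of b^-1 and so is fixed by b^-1 b; commuting b b^-1 with a^-1 a
  then shows that a^-1 a fixes \<open>b s\<close>.\<close>

lemma defined_at_mult_iff:
  assumes "a \<in> carrier M" "b \<in> carrier M"
  shows "defined_at M (a \<otimes> b) s \<longleftrightarrow> defined_at M b s \<and> defined_at M a (b \<otimes> s)"
proof
  assume d: "defined_at M (a \<otimes> b) s"
  then have s: "s \<in> carrier M"
    by (simp add: defined_at_def)
  have eq: "sinv M b \<otimes> (sinv M a \<otimes> (a \<otimes> (b \<otimes> s))) = s"
    using assms d s by (simp add: defined_at_def sinv_mult m_assoc)
  have "sinv M b \<otimes> (b \<otimes> s) = sinv M b \<otimes> (b \<otimes> (sinv M b \<otimes> (sinv M a \<otimes> (a \<otimes> (b \<otimes> s)))))"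
    by (simp only: eq)
  also have "\<dots> = sinv M b \<otimes> (sinv M a \<otimes> (a \<otimes> (b \<otimes> s)))"
    using assms s by (simp add: sinv_simps)
  finally have b: "sinv M b \<otimes> (b \<otimes> s) = s"
    using eq by simp
  have "b \<otimes> s = b \<otimes> (sinv M b \<otimes> (sinv M a \<otimes> (a \<otimes> (b \<otimes> s))))"
    by (simp only: eq)
  also have "\<dots> = (b \<otimes> sinv M b) \<otimes> ((sinv M a \<otimes> a) \<otimes> (b \<otimes> s))"
    using assms s by (simp add: m_assoc)
  also have "\<dots> = (sinv M a \<otimes> a) \<otimes> ((b \<otimes> sinv M b) \<otimes> (b \<otimes> s))"
    using assms s by (intro idems_left_comm mult_sinv_idem sinv_mult_idem) auto
  also have "\<dots> = sinv M a \<otimes> (a \<otimes> (b \<otimes> s))"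
    using assms s by (simp add: m_assoc sinv_simps)
  finally show "defined_at M b s \<and> defined_at M a (b \<otimes> s)"
    using b s assms by (simp add: defined_at_def)
next
  assume "defined_at M b s \<and> defined_at M a (b \<otimes> s)"
  then show "defined_at M (a \<otimes> b) s"
    using assms by (simp add: defined_at_def sinv_mult m_assoc)
qed

lemma defined_at_sinv:
  "\<lbrakk>a \<in> carrier M; defined_at M a s\<rbrakk> \<Longrightarrow> defined_at M (sinv M a) (a \<otimes> s)"
  by (simp add: defined_at_def)

text \<open>Existing paths survive right translation by every \<open>t\<close>, which is why the
  right action on chains is compatible with them.\<close>

lemma defined_at_mult_right:
  assumes "a \<in> carrier M" "t \<in> carrier M" "defined_at M a s"
  shows "defined_at M a (s \<otimes> t)"
proof -
  have s: "s \<in> carrier M" and "sinv M a \<otimes> (a \<otimes> s) \<otimes> t = s \<otimes> t"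
    using assms by (simp_all add: defined_at_def)
  then show ?thesis
    using assms(1,2) by (simp add: defined_at_def m_assoc)
qed

lemma defined_at_idem_iff:
  "\<lbrakk>e \<in> idems M; s \<in> carrier M\<rbrakk> \<Longrightarrow> defined_at M e s \<longleftrightarrow> e \<otimes> s = s"
  by (simp add: defined_at_def sinv_idem idems_left_idem idems_closed)

lemma mult_source_idem:
  "\<lbrakk>s \<in> carrier M; sinv M s \<otimes> s = e\<rbrakk> \<Longrightarrow> s \<otimes> e = s"
  using mult_sinv_mult by blast

lemma defined_at_source:
  "\<lbrakk>s \<in> carrier M; sinv M s \<otimes> s = e\<rbrakk> \<Longrightarrow> defined_at M s e"
  using mult_source_idem[of s e] by (auto simp: defined_at_def)

text \<open>Hence a path never leaves the component of its first vertex.\<close>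

lemma defined_at_same_source:
  assumes "a \<in> carrier M" "defined_at M a s"
  shows "sinv M (a \<otimes> s) \<otimes> (a \<otimes> s) = sinv M s \<otimes> s"
  using assms by (simp add: defined_at_def sinv_mult m_assoc)

lemma conj_source:
  "\<lbrakk>s \<in> carrier M; t \<in> carrier M\<rbrakk>
    \<Longrightarrow> sinv M (s \<otimes> t) \<otimes> (s \<otimes> t) = sinv M t \<otimes> (sinv M s \<otimes> s) \<otimes> t"
  by (simp add: sinv_mult m_assoc)

end


section \<open>Words over a presentation\<close>

locale presentation =
  fixes X :: "'x set" and R :: "('x word \<times> 'x word) set"
  assumes relators: "R \<subseteq> carrier (free_monoid X) \<times> carrier (free_monoid X)"
begin

abbreviation W :: "'x word set" where "W \<equiv> carrier (free_monoid X)"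

abbreviation M :: "'x fim_elem set monoid" where "M \<equiv> pres_monoid X R"

abbreviation T :: "'x fim_elem set monoid" where "T \<equiv> T_monoid X R"

abbreviation mult_M (infixl "\<cdot>" 70) where "a \<cdot> b \<equiv> a \<otimes>\<^bsub>M\<^esub> b"

abbreviation mult_T (infixl "\<odot>" 70) where "a \<odot> b \<equiv> a \<otimes>\<^bsub>T\<^esub> b"

definition ev :: "'x word \<Rightarrow> 'x fim_elem set" where
  "ev w = theta X R (fim_map X w)"

definition tv :: "'x word \<Rightarrow> 'x fim_elem set" where
  "tv w = theta_min X R `` {fim_map X w}"

lemma congruence_pres_cong: "congruence (FIM X) (pres_cong X R)"
  unfolding pres_cong_def
  using relators inverse_monoid_FIM[of X]
  by (intro congruence_cong_gen) (auto simp: inverse_monoid_def)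

sublocale M: inverse_monoid M
  unfolding pres_monoid_def by (intro inverse_monoid_quot_monoid inverse_monoid_FIM congruence_pres_cong)

lemma theta_hom: "theta X R \<in> hom (FIM X) M"
  using quot_monoid_hom[OF congruence_pres_cong] by (simp add: theta_def[abs_def] pres_monoid_def)

lemma congruence_theta_min: "congruence (FIM X) (theta_min X R)"
  unfolding theta_min_eq
  by (rule inverse_monoid.congruence_min_cong[OF inverse_monoid_FIM M.inverse_monoid_axioms theta_hom])

sublocale T: inverse_monoid T
  unfolding T_monoid_def by (intro inverse_monoid_quot_monoid inverse_monoid_FIM congruence_theta_min)

lemma tau_hom: "(\<lambda>a. theta_min X R `` {a}) \<in> hom (FIM X) T"
  using quot_monoid_hom[OF congruence_theta_min] by (simp add: T_monoid_def)

lemma ev_closed [simp]: "w \<in> W \<Longrightarrow> ev w \<in> carrier M"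
  using theta_hom by (auto simp: ev_def hom_def)

lemma tv_closed [simp]: "w \<in> W \<Longrightarrow> tv w \<in> carrier T"
  using tau_hom by (auto simp: tv_def hom_def)

lemma ev_append: "\<lbrakk>u \<in> W; v \<in> W\<rbrakk> \<Longrightarrow> ev (u @ v) = ev u \<cdot> ev v"
  using theta_hom by (simp add: ev_def fim_map_append hom_mult)

lemma tv_append: "\<lbrakk>u \<in> W; v \<in> W\<rbrakk> \<Longrightarrow> tv (u @ v) = tv u \<odot> tv v"
  using hom_mult[OF tau_hom] by (simp add: tv_def fim_map_append)

lemma ev_word_inv: "w \<in> W \<Longrightarrow> ev (word_inv w) = sinv M (ev w)"
  by (simp add: ev_def fim_map_word_inv inverse_monoid.hom_sinv[OF inverse_monoid_FIM _ theta_hom]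
      M.inverse_monoid_axioms)

lemma tv_word_inv: "w \<in> W \<Longrightarrow> tv (word_inv w) = sinv T (tv w)"
  using inverse_monoid.hom_sinv[OF inverse_monoid_FIM T.inverse_monoid_axioms tau_hom, of "fim_map X w"]
  by (simp add: tv_def fim_map_word_inv)

lemma ev_Nil [simp]: "ev [] = \<one>\<^bsub>M\<^esub>"
  by (simp add: ev_def fim_map_def theta_def pres_monoid_def FIM_def quot_monoid_one free_monoid_simps)

lemma ev_surj:
  assumes "m \<in> carrier M"
  obtains w where "w \<in> W" "ev w = m"
  using assms unfolding pres_monoid_def ev_def theta_def
  by (metis quot_monoid_elem fim_map_surj)

lemma tv_surj:
  assumes "t \<in> carrier T"
  obtains w where "w \<in> W" "tv w = t"
  using assms unfolding T_monoid_def tv_def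
  by (metis quot_monoid_elem fim_map_surj)

lemma tv_eq_iff: "\<lbrakk>u \<in> W; v \<in> W\<rbrakk> \<Longrightarrow> tv u = tv v \<longleftrightarrow> (fim_map X u, fim_map X v) \<in> theta_min X R"
  unfolding tv_def by (rule congruence_class_eq_iff[OF congruence_theta_min]) simp_all

lemma theta_min_imp_eq: "(a, b) \<in> theta_min X R \<Longrightarrow> theta X R a = theta X R b"
  unfolding theta_min_eq
  by (rule inverse_monoid.min_cong_imp_eq[OF inverse_monoid_FIM M.inverse_monoid_axioms theta_hom])

lemma psi_tv [simp]:
  assumes "w \<in> W"
  shows "psi X R (tv w) = ev w"
proof -
  have "(fim_map X w, fim_map X w) \<in> theta_min X R"
    using assms congruence_equiv[OF congruence_theta_min] by (auto simp: equiv_def refl_on_def)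
  then have "theta X R ` tv w = {ev w}"
    unfolding tv_def ev_def by (auto dest: theta_min_imp_eq intro: rev_image_eqI)
  then show ?thesis
    by (simp add: psi_def)
qed

lemma psi_hom: "psi X R \<in> hom T M"
proof (rule homI)
  fix a b assume "a \<in> carrier T" "b \<in> carrier T"
  then obtain u v where uv: "u \<in> W" "a = tv u" "v \<in> W" "b = tv v"
    by (metis tv_surj)
  have "psi X R (tv (u @ v)) = ev (u @ v)"
    using uv by (intro psi_tv) simp
  then show "psi X R (a \<odot> b) = psi X R a \<cdot> psi X R b"
    using uv by (simp add: ev_append tv_append)
qed (metis ev_closed psi_tv tv_surj)

lemma psi_closed [simp]: "t \<in> carrier T \<Longrightarrow> psi X R t \<in> carrier M"
  using psi_hom by (auto simp: hom_def)

lemma psi_mult [simp]: "\<lbrakk>s \<in> carrier T; t \<in> carrier T\<rbrakk> \<Longrightarrow> psi X R (s \<odot> t) = psi X R s \<cdot> psi X R t"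
  using psi_hom by (auto simp: hom_def)

lemma psi_sinv [simp]: "t \<in> carrier T \<Longrightarrow> psi X R (sinv T t) = sinv M (psi X R t)"
  by (rule T.hom_sinv[OF M.inverse_monoid_axioms psi_hom])

lemma psi_surj:
  assumes "m \<in> carrier M"
  obtains t where "t \<in> carrier T" "psi X R t = m"
  using assms by (metis ev_surj psi_tv tv_closed)

lemma psi_idem_separating:
  assumes "e \<in> idems T" "f \<in> idems T" "psi X R e = psi X R f"
  shows "e = f"
proof -
  obtain a where a: "a \<in> idems (FIM X)" "e = theta_min X R `` {a}"
    using assms(1) quot_monoid_idem_lift[OF inverse_monoid_FIM congruence_theta_min]
    unfolding T_monoid_def by metis
  obtain b where b: "b \<in> idems (FIM X)" "f = theta_min X R `` {b}"
    using assms(2) quot_monoid_idem_lift[OF inverse_monoid_FIM congruence_theta_min]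
    unfolding T_monoid_def by metis
  obtain u v where uv: "u \<in> W" "a = fim_map X u" "v \<in> W" "b = fim_map X v"
    using a b by (metis fim_map_surj idems_closed)
  have "psi X R e = theta X R a" "psi X R f = theta X R b"
    using a b uv psi_tv[of u] psi_tv[of v] by (simp_all add: tv_def ev_def)
  then have "(a, b) \<in> theta_min X R"
    unfolding theta_min_eq using assms a b
    by (intro inverse_monoid.min_cong_idems[OF inverse_monoid_FIM M.inverse_monoid_axioms theta_hom]) auto
  then show ?thesis
    using a b congruence_class_eq_iff[OF congruence_theta_min] idems_closed by metis
qed

text \<open>Since \<open>psi\<close> separates idempotents, a a^-1 = b b^-1 in T. The lemma removes
  the detours that arise when loops are multiplied.\<close>

lemma psi_eq_range_absorb:
  assumes "a \<in> carrier T" "b \<in> carrier T" "psi X R a = psi X R b"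
  shows "a \<odot> (sinv T a \<odot> b) = b"
proof -
  have "a \<odot> sinv T a = b \<odot> sinv T b"
    by (rule psi_idem_separating) (use assms in \<open>simp_all add: T.mult_sinv_idem\<close>)
  then have "a \<odot> sinv T a \<odot> b = b \<odot> sinv T b \<odot> b"
    by (rule arg_cong)
  then show ?thesis
    using assms(1,2) by (simp add: T.m_assoc T.mult_sinv_mult)
qed


section \<open>Chains of paths\<close>

text \<open>An inverse letter runs through an edge backwards, so that edge starts at the vertex
  where the step ends.\<close>

definition letter_chain :: "'x + 'x \<Rightarrow> 'x fim_elem set \<Rightarrow> 'x \<times> 'x fim_elem set \<Rightarrow>\<^sub>0 int" where
  "letter_chain a s = (case a of Inl x \<Rightarrow> frag_of (x, s) | Inr x \<Rightarrow> - frag_of (x, ev [Inr x] \<cdot> s))"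

text \<open>The path from \<open>s\<close> labelled \<open>w\<close> reads \<open>w\<close> from right to left, since edges multiply on the left.\<close>

primrec path_chain :: "'x word \<Rightarrow> 'x fim_elem set \<Rightarrow> 'x \<times> 'x fim_elem set \<Rightarrow>\<^sub>0 int" where
  "path_chain [] s = 0"
| "path_chain (a # w) s = path_chain w s + letter_chain a (ev w \<cdot> s)"

lemma ev_Cons: "\<lbrakk>a \<in> X <+> X; w \<in> W\<rbrakk> \<Longrightarrow> ev (a # w) = ev [a] \<cdot> ev w"
  using ev_append[of "[a]" w] by simp

lemma ev_Inr: "x \<in> X \<Longrightarrow> ev [Inr x] = sinv M (ev [Inl x])"
  using ev_word_inv[of "[Inl x]"] by (simp add: word_inv_def)

lemma ev_word_inv_letter: "a \<in> X <+> X \<Longrightarrow> ev (word_inv [a]) = sinv M (ev [a])"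
  by (rule ev_word_inv) simp

lemma path_chain_append:
  "\<lbrakk>u \<in> W; v \<in> W; s \<in> carrier M\<rbrakk> \<Longrightarrow> path_chain (u @ v) s = path_chain v s + path_chain u (ev v \<cdot> s)"
  by (induction u) (simp_all add: ev_append M.m_assoc)

lemma letter_chain_inv:
  assumes "a \<in> X <+> X" "defined_at M (ev [a]) s"
  shows "path_chain (word_inv [a]) (ev [a] \<cdot> s) = - letter_chain a s"
proof (cases a)
  case (Inl x)
  then show ?thesis
    using assms by (simp add: word_inv_def letter_chain_def defined_at_def ev_Inr)
next
  case (Inr x)
  then show ?thesis
    using assms by (auto simp: word_inv_def letter_chain_def defined_at_def)
qed

text \<open>The inverse of a letter undoes it only at vertices where the letter is defined;
  existence of the path guarantees this at each step, so that the way back uses the same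
  edges.\<close>

lemma path_chain_word_inv:
  assumes "w \<in> W" "defined_at M (ev w) s"
  shows "path_chain (word_inv w) (ev w \<cdot> s) = - path_chain w s"
  using assms
proof (induction w arbitrary: s)
  case (Cons a w)
  have aw: "a \<in> X <+> X" "w \<in> W" "[a] \<in> W" "word_inv [a] \<in> W" "word_inv w \<in> W"
    using Cons.prems word_inv_closed[of "[a]" X] by simp_all
  have s: "s \<in> carrier M"
    using Cons.prems by (simp add: defined_at_def)
  have d: "defined_at M (ev w) s" "defined_at M (ev [a]) (ev w \<cdot> s)"
    using Cons.prems aw by (simp_all add: ev_Cons[of a w] M.defined_at_mult_iff)
  have "path_chain (word_inv (a # w)) (ev (a # w) \<cdot> s) =
      path_chain (word_inv w @ word_inv [a]) (ev [a] \<cdot> (ev w \<cdot> s))"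
    using aw s word_inv_append[of "[a]" w] by (simp add: ev_Cons[of a w] M.m_assoc)
  also have "\<dots> = path_chain (word_inv [a]) (ev [a] \<cdot> (ev w \<cdot> s)) +
      path_chain (word_inv w) (sinv M (ev [a]) \<cdot> (ev [a] \<cdot> (ev w \<cdot> s)))"
    using aw s by (simp add: path_chain_append ev_word_inv_letter)
  also have "\<dots> = - letter_chain a (ev w \<cdot> s) + path_chain (word_inv w) (ev w \<cdot> s)"
    using aw d by (simp add: letter_chain_inv) (simp add: defined_at_def)
  finally show ?case
    using Cons.IH[OF aw(2) d(1)] by simp
qed simp

text \<open>The word \<open>[Inr x, Inl x]\<close> evaluates to x^-1 x, so the order condition on an
  edge says that the one-letter path from its source exists.\<close>

lemma comp_edges_iff:
  "(x, s) \<in> comp_edges X R e \<longleftrightarrow> x \<in> X \<and> defined_at M (ev [Inl x]) s \<and> sinv M s \<cdot> s = e"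
proof (cases "x \<in> X \<and> s \<in> carrier M")
  case True
  then have xs: "x \<in> X" "s \<in> carrier M"
    by auto
  have "theta X R (fim_map X [Inr x, Inl x]) = ev ([Inr x] @ [Inl x])"
    by (simp add: ev_def)
  also have "\<dots> = sinv M (ev [Inl x]) \<cdot> ev [Inl x]"
    using xs by (subst ev_append) (simp_all add: ev_Inr)
  finally have "nat_le M (s \<cdot> sinv M s) (theta X R (fim_map X [Inr x, Inl x])) \<longleftrightarrow>
      sinv M (ev [Inl x]) \<cdot> ev [Inl x] \<cdot> s = s"
    using xs by (simp add: M.nat_le_mult_sinv_iff M.sinv_mult_idem)
  then show ?thesis
    using xs by (auto simp: comp_edges_def sch_edges_def sch_source_def L_class_def Let_def
        defined_at_def M.m_assoc)
next
  case False
  then show ?thesis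
    by (auto simp: comp_edges_def sch_edges_def Let_def defined_at_def)
qed

lemma path_chain_keys:
  assumes "w \<in> W" "defined_at M (ev w) s" "sinv M s \<cdot> s = e"
  shows "Poly_Mapping.keys (path_chain w s) \<subseteq> comp_edges X R e"
  using assms
proof (induction w)
  case (Cons a w)
  have aw: "a \<in> X <+> X" "w \<in> W"
    using Cons.prems by simp_all
  have d: "defined_at M (ev w) s" "defined_at M (ev [a]) (ev w \<cdot> s)"
    using Cons.prems aw by (simp_all add: ev_Cons[of a w] M.defined_at_mult_iff)
  have e: "sinv M (ev w \<cdot> s) \<cdot> (ev w \<cdot> s) = e"
    using aw d Cons.prems(3) by (simp add: M.defined_at_same_source)
  have "Poly_Mapping.keys (letter_chain a (ev w \<cdot> s)) \<subseteq> comp_edges X R e"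
  proof (cases a)
    case (Inl x)
    then show ?thesis
      using aw d e by (auto simp: letter_chain_def comp_edges_iff)
  next
    case (Inr x)
    then have x: "x \<in> X"
      using aw by auto
    then have "defined_at M (ev [Inl x]) (ev [Inr x] \<cdot> (ev w \<cdot> s))"
      using M.defined_at_sinv[OF _ d(2)] Inr by (simp add: ev_Inr)
    moreover have "sinv M (ev [Inr x] \<cdot> (ev w \<cdot> s)) \<cdot> (ev [Inr x] \<cdot> (ev w \<cdot> s)) = e"
      using x d(2) Inr e by (simp add: M.defined_at_same_source)
    ultimately show ?thesis
      using Inr x by (simp add: letter_chain_def comp_edges_iff)
  qed
  then show ?case
    using Cons.IH[OF aw(2) d(1) Cons.prems(3)] keys_add by fastforce
qed simp

section \<open>Boundaries of path chains\<close>

lemma sch_boundary_add: "sch_boundary X R (a + b) = sch_boundary X R a + sch_boundary X R b"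
  by (simp add: sch_boundary_def frag_extend_add)

lemma sch_boundary_diff: "sch_boundary X R (a - b) = sch_boundary X R a - sch_boundary X R b"
  by (simp add: sch_boundary_def frag_extend_diff)

lemma sch_boundary_minus: "sch_boundary X R (- a) = - sch_boundary X R a"
  by (simp add: sch_boundary_def frag_extend_minus)

lemma sch_boundary_edge: "sch_boundary X R (frag_of (x, s)) = frag_of (ev [Inl x] \<cdot> s) - frag_of s"
  by (simp add: sch_boundary_def sch_target_def sch_source_def gen_img_def ev_def)

text \<open>The boundaries of the single steps telescope; in particular closed paths give
  cycles.\<close>

lemma sch_boundary_path:
  assumes "w \<in> W" "defined_at M (ev w) s"
  shows "sch_boundary X R (path_chain w s) = frag_of (ev w \<cdot> s) - frag_of s"
  using assms
proof (induction w)
  case Nil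
  then show ?case
    by (simp add: sch_boundary_def defined_at_def)
next
  case (Cons a w)
  have aw: "a \<in> X <+> X" "w \<in> W"
    using Cons.prems by simp_all
  have s: "s \<in> carrier M"
    using Cons.prems by (simp add: defined_at_def)
  have d: "defined_at M (ev w) s" "defined_at M (ev [a]) (ev w \<cdot> s)"
    using Cons.prems aw by (simp_all add: ev_Cons[of a w] M.defined_at_mult_iff)
  have "sch_boundary X R (letter_chain a (ev w \<cdot> s)) = frag_of (ev [a] \<cdot> (ev w \<cdot> s)) - frag_of (ev w \<cdot> s)"
  proof (cases a)
    case (Inl x)
    then show ?thesis
      by (simp add: letter_chain_def sch_boundary_edge)
  next
    case (Inr x)
    then show ?thesis
      using aw d(2) by (auto simp: letter_chain_def sch_boundary_edge sch_boundary_minus ev_Inr defined_at_def)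
  qed
  then show ?case
    using Cons.IH[OF aw(2) d(1)] aw s by (simp add: sch_boundary_add ev_Cons[of a w] M.m_assoc)
qed

section \<open>Right translation of path chains\<close>

lemma C1_act_add: "C1_act X R t (a + b) = C1_act X R t a + C1_act X R t b"
  by (simp add: C1_act_def frag_extend_add)

lemma C1_act_minus: "C1_act X R t (- a) = - C1_act X R t a"
  by (simp add: C1_act_def frag_extend_minus)

lemma C1_act_edge: "C1_act X R t (frag_of (x, s)) = frag_of (x, s \<cdot> t)"
  by (simp add: C1_act_def)

text \<open>Steps of a path multiply on the left and so commute with right translation.\<close>

lemma C1_act_path:
  assumes "w \<in> W" "s \<in> carrier M" "t \<in> carrier M"
  shows "C1_act X R t (path_chain w s) = path_chain w (s \<cdot> t)"
  using assms
proof (induction w)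
  case Nil
  then show ?case
    by (simp add: C1_act_def)
next
  case (Cons a w)
  then show ?case
    by (auto simp: C1_act_add C1_act_minus C1_act_edge letter_chain_def M.m_assoc split: sum.split)
qed


section \<open>Invariance of the chain of a path\<close>

text \<open>Only the paths that exist in the graph, i.e. those with \<open>defined_at M (ev u) s\<close>, have a chain
  invariant under the Wagner congruence.\<close>

definition chain_cong :: "('x word \<times> 'x word) set" where
  "chain_cong = {(u, v). u \<in> W \<and> v \<in> W \<and> ev u = ev v \<and>
     (\<forall>s. defined_at M (ev u) s \<longrightarrow> path_chain u s = path_chain v s)}"

lemma congruence_chain_cong: "congruence (free_monoid X) chain_cong"
proof -
  have "equiv W chain_cong"
    by (rule equivI) (auto simp: chain_cong_def intro!: refl_onI symI transI)
  moreover have "(a @ c, b @ d) \<in> chain_cong" if ab: "(a, b) \<in> chain_cong" and cd: "(c, d) \<in> chain_cong"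
    for a b c d
  proof -
    have w: "a \<in> W" "b \<in> W" "c \<in> W" "d \<in> W" and e: "ev a = ev b" "ev c = ev d"
      using ab cd by (auto simp: chain_cong_def)
    have "path_chain (a @ c) s = path_chain (b @ d) s" if "defined_at M (ev (a @ c)) s" for s
    proof -
      have s: "s \<in> carrier M"
        using that by (simp add: defined_at_def)
      have "defined_at M (ev c) s" "defined_at M (ev a) (ev c \<cdot> s)"
        using that w by (simp_all add: ev_append M.defined_at_mult_iff)
      then have "path_chain c s = path_chain d s" "path_chain a (ev c \<cdot> s) = path_chain b (ev c \<cdot> s)"
        using ab cd by (auto simp: chain_cong_def)
      then show ?thesis
        using w s e by (simp add: path_chain_append)
    qed
    then show ?thesis
      using w e by (simp add: chain_cong_def ev_append)
  qed
  ultimately show ?thesis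
    by (simp add: congruence_def free_monoid_simps)
qed

lemma path_chain_range:
  assumes "u \<in> W" "defined_at M (ev u \<cdot> sinv M (ev u)) s"
  shows "path_chain (u @ word_inv u) s = 0"
proof -
  have u: "ev u \<in> carrier M" "word_inv u \<in> W" "s \<in> carrier M"
    using assms by (simp_all add: defined_at_def)
  have d: "defined_at M (sinv M (ev u)) s"
    using assms M.defined_at_mult_iff[of "ev u" "sinv M (ev u)" s] by simp
  \<comment> \<open>Read from right to left, the path first follows \<open>word_inv u\<close> and
    then retraces it along \<open>u\<close>.\<close>
  then have "path_chain (word_inv (word_inv u)) (ev (word_inv u) \<cdot> s) = - path_chain (word_inv u) s"
    using assms(1) u by (intro path_chain_word_inv) (simp_all add: ev_word_inv)
  then show ?thesis
    using assms(1) u by (simp add: path_chain_append)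
qed

lemma wagner_subset_chain_cong: "wagner X \<subseteq> chain_cong"
  unfolding wagner_def
proof (rule cong_gen_least[OF congruence_chain_cong], safe)
  fix u assume "u \<in> carrier (free_monoid X)"
  then have u: "u \<in> W" "word_inv u \<in> W"
    by simp_all
  have ev: "ev (u @ word_inv u @ u) = ev u"
    using u by (simp add: ev_append ev_word_inv M.sinv_simps)
  moreover have "path_chain (u @ word_inv u @ u) s = path_chain u s" if d: "defined_at M (ev u) s" for s
  proof -
    have s: "s \<in> carrier M"
      using d by (simp add: defined_at_def)
    have "ev u \<cdot> sinv M (ev u) \<cdot> ev u = ev u"
      using u by (simp add: M.m_assoc M.sinv_simps)
    then have "defined_at M (ev u \<cdot> sinv M (ev u)) (ev u \<cdot> s)"
      using d u M.defined_at_mult_iff[of "ev u \<cdot> sinv M (ev u)" "ev u" s] by simp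
    then have "path_chain (u @ word_inv u) (ev u \<cdot> s) = 0"
      using u by (intro path_chain_range)
    then show ?thesis
      using u s path_chain_append[of "u @ word_inv u" u s] by simp
  qed
  ultimately show "(u @ word_inv u @ u, u) \<in> chain_cong"
    using u unfolding chain_cong_def by simp
next
  fix u v assume "u \<in> carrier (free_monoid X)" "v \<in> carrier (free_monoid X)"
  then have uv: "u \<in> W" "word_inv u \<in> W" "v \<in> W" "word_inv v \<in> W"
    by simp_all
  have i: "ev u \<cdot> sinv M (ev u) \<in> idems M" "ev v \<cdot> sinv M (ev v) \<in> idems M"
    using uv by (simp_all add: M.mult_sinv_idem)
  have eva: "ev ((a @ word_inv a) @ b @ word_inv b) = (ev a \<cdot> sinv M (ev a)) \<cdot> (ev b \<cdot> sinv M (ev b))"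
    if "a \<in> W" "b \<in> W" "word_inv a \<in> W" "word_inv b \<in> W" for a b
    using that by (simp add: ev_append ev_word_inv M.m_assoc)
  have ev: "ev ((u @ word_inv u) @ v @ word_inv v) = ev ((v @ word_inv v) @ u @ word_inv u)"
    using uv M.idems_comm[OF i] by (simp only: eva)
  \<comment> \<open>Both sides of the commutation relation have chain zero, so the two paths, which
    visit different vertices in general, need not be compared.\<close>
  have zero: "path_chain ((a @ word_inv a) @ b @ word_inv b) s = 0"
    if w: "a \<in> W" "b \<in> W" "word_inv a \<in> W" "word_inv b \<in> W"
      and d: "defined_at M (ev ((a @ word_inv a) @ b @ word_inv b)) s" for a b s
  proof -
    have s: "s \<in> carrier M"
      using d by (simp add: defined_at_def)
    have "defined_at M (ev b \<cdot> sinv M (ev b)) s"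
      "defined_at M (ev a \<cdot> sinv M (ev a)) (ev (b @ word_inv b) \<cdot> s)"
      using d w unfolding eva[OF w] by (simp_all add: M.defined_at_mult_iff[of "ev a \<cdot> sinv M (ev a)"]
        ev_append ev_word_inv)
    then have "path_chain (b @ word_inv b) s = 0" "path_chain (a @ word_inv a) (ev (b @ word_inv b) \<cdot> s) = 0"
      using w by (simp_all add: path_chain_range)
    then show ?thesis
      using w s path_chain_append[of "a @ word_inv a" "b @ word_inv b" s] by simp
  qed
  have "((u @ word_inv u) @ v @ word_inv v, (v @ word_inv v) @ u @ word_inv u) \<in> chain_cong"
    unfolding chain_cong_def using uv ev zero[of u v] zero[of v u] by (simp del: append_assoc)
  then show "(u @ word_inv u @ v @ word_inv v, v @ word_inv v @ u @ word_inv u) \<in> chain_cong"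
    by simp
qed

lemma path_chain_fim:
  "\<lbrakk>u \<in> W; v \<in> W; fim_map X u = fim_map X v; defined_at M (ev u) s\<rbrakk> \<Longrightarrow> path_chain u s = path_chain v s"
  using wagner_subset_chain_cong by (auto simp: fim_map_eq_iff chain_cong_def)

lemma path_chain_tv:
  assumes u: "u \<in> W" and v: "v \<in> W" and eq: "tv u = tv v" and d: "defined_at M (ev u) s"
  shows "path_chain u s = path_chain v s"
proof -
  interpret F: inverse_monoid "FIM X" by (rule inverse_monoid_FIM)
  have s: "s \<in> carrier M"
    using d by (simp add: defined_at_def)
  obtain e where e: "e \<in> idems (FIM X)" "fim_map X u \<otimes>\<^bsub>FIM X\<^esub> e = fim_map X v \<otimes>\<^bsub>FIM X\<^esub> e"
    "theta X R (sinv (FIM X) (fim_map X u) \<otimes>\<^bsub>FIM X\<^esub> fim_map X u) = theta X R e"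
    using eq u v by (auto simp: tv_eq_iff theta_min_def)
  obtain w where w: "w \<in> W" "e = fim_map X w"
    using e(1) by (metis fim_map_surj idems_closed)
  have "ev w = ev (word_inv u @ u)"
    using e(3) u w by (simp add: ev_def fim_map_append fim_map_word_inv)
  then have evw: "ev w = sinv M (ev u) \<cdot> ev u"
    using u by (simp add: ev_append ev_word_inv)
  then have ws: "ev w \<cdot> s = s"
    using d u by (simp add: defined_at_def M.m_assoc)
  then have dw: "defined_at M (ev w) s"
    using s u by (simp add: evw M.defined_at_idem_iff M.sinv_mult_idem)
  \<comment> \<open>As \<open>w\<close> fixes \<open>s\<close>, the chain of \<open>w @ w\<close> is
    twice that of \<open>w\<close>. Both words represent the same idempotent, so the chain equals
    its double and is zero.\<close>
  have "path_chain (w @ w) s = path_chain w s"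
    using w e(1) dw ws s by (intro path_chain_fim)
      (simp_all add: fim_map_append idems_idem ev_append M.defined_at_mult_iff)
  then have zero: "path_chain w s = 0"
    using w ws s by (simp add: path_chain_append)
  \<comment> \<open>The two words agree already in the free inverse monoid, and reading
    \<open>w\<close> first neither moves \<open>s\<close> nor contributes to the chain.\<close>
  have "path_chain (u @ w) s = path_chain (v @ w) s"
    using u v w e(2) d dw ws by (intro path_chain_fim)
      (simp_all add: fim_map_append ev_append M.defined_at_mult_iff)
  then show ?thesis
    using u v w s zero ws by (simp add: path_chain_append)
qed

text \<open>The value is independent of the chosen word at vertices where the path exists, by
  \<open>path_chain_tv\<close>; elsewhere it is an arbitrary default.\<close>

definition elem_chain :: "'x fim_elem set \<Rightarrow> 'x fim_elem set \<Rightarrow> 'x \<times> 'x fim_elem set \<Rightarrow>\<^sub>0 int" where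
  "elem_chain t = path_chain (SOME w. w \<in> W \<and> tv w = t)"

lemma elem_chain_tv:
  assumes "w \<in> W" "defined_at M (ev w) s"
  shows "elem_chain (tv w) s = path_chain w s"
proof -
  define v where "v = (SOME v. v \<in> W \<and> tv v = tv w)"
  have v: "v \<in> W \<and> tv v = tv w"
    unfolding v_def by (rule someI[of _ w]) (simp add: assms)
  have "path_chain w s = path_chain v s"
    by (rule path_chain_tv) (simp_all add: assms v)
  then show ?thesis
    by (simp add: elem_chain_def v_def)
qed

lemma elem_chain_mult:
  assumes "t \<in> carrier T" "u \<in> carrier T" "defined_at M (psi X R t \<cdot> psi X R u) s"
  shows "elem_chain (t \<odot> u) s = elem_chain u s + elem_chain t (psi X R u \<cdot> s)"
proof -
  obtain v w where vw: "v \<in> W" "t = tv v" "w \<in> W" "u = tv w"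
    using assms by (metis tv_surj)
  have s: "s \<in> carrier M"
    using assms(3) by (simp add: defined_at_def)
  have "defined_at M (ev (v @ w)) s" "defined_at M (ev w) s" "defined_at M (ev v) (ev w \<cdot> s)"
    using assms(3) vw M.defined_at_mult_iff[of "ev v" "ev w" s] by (simp_all add: ev_append)
  moreover have "t \<odot> u = tv (v @ w)"
    using vw by (simp add: tv_append)
  ultimately show ?thesis
    using vw(1,3) s by (simp add: vw(2,4) elem_chain_tv path_chain_append)
qed

lemma elem_chain_sinv:
  assumes "t \<in> carrier T" "defined_at M (psi X R t) s"
  shows "elem_chain (sinv T t) (psi X R t \<cdot> s) = - elem_chain t s"
proof -
  obtain w where w: "w \<in> W" "t = tv w"
    using assms by (metis tv_surj)
  then have d: "defined_at M (ev w) s" "defined_at M (ev (word_inv w)) (ev w \<cdot> s)"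
    using assms M.defined_at_sinv by (auto simp: ev_word_inv)
  have "sinv T t = tv (word_inv w)"
    using w by (simp add: tv_word_inv)
  then show ?thesis
    using w d by (auto simp: elem_chain_tv path_chain_word_inv)
qed

lemma elem_chain_act:
  assumes "t \<in> carrier T" "m \<in> carrier M" "defined_at M (psi X R t) s"
  shows "C1_act X R m (elem_chain t s) = elem_chain t (s \<cdot> m)"
proof -
  obtain w where w: "w \<in> W" "t = tv w"
    using assms by (metis tv_surj)
  then have "defined_at M (ev w) s" "s \<in> carrier M"
    using assms by (auto simp: defined_at_def)
  then show ?thesis
    using w assms M.defined_at_mult_right[of "ev w" m s] by (auto simp: elem_chain_tv C1_act_path)
qed

lemma elem_chain_keys:
  assumes "t \<in> carrier T" "defined_at M (psi X R t) s" "sinv M s \<cdot> s = e"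
  shows "Poly_Mapping.keys (elem_chain t s) \<subseteq> comp_edges X R e"
proof -
  obtain w where "w \<in> W" "t = tv w"
    using assms by (metis tv_surj)
  then show ?thesis
    using assms by (auto simp: elem_chain_tv dest: path_chain_keys)
qed

lemma sch_boundary_elem_chain:
  assumes "t \<in> carrier T" "defined_at M (psi X R t) s"
  shows "sch_boundary X R (elem_chain t s) = frag_of (psi X R t \<cdot> s) - frag_of s"
proof -
  obtain w where "w \<in> W" "t = tv w"
    using assms by (metis tv_surj)
  then show ?thesis
    using assms by (auto simp: elem_chain_tv sch_boundary_path)
qed


section \<open>The kernel groups\<close>

abbreviation K :: "'x fim_elem set \<Rightarrow> 'x fim_elem set monoid" where "K \<equiv> K_group X R"

lemma K_carrier_iff: "k \<in> carrier (K e) \<longleftrightarrow> k \<in> carrier T \<and> psi X R k = e"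
  by (simp add: K_group_def)

lemma K_mult: "k \<otimes>\<^bsub>K e\<^esub> l = k \<odot> l"
  by (simp add: K_group_def)

lemma K_one_eq:
  assumes "f \<in> idems T" "psi X R f = e"
  shows "\<one>\<^bsub>K e\<^esub> = f"
proof -
  have "(THE g. g \<in> idems T \<and> psi X R g = e) = f"
  proof (rule the_equality)
    fix g assume "g \<in> idems T \<and> psi X R g = e"
    then show "g = f"
      by (intro psi_idem_separating[of g f]) (simp_all add: assms)
  qed (simp add: assms)
  then show ?thesis
    by (simp add: K_group_def)
qed

lemma K_one_idem:
  assumes "e \<in> idems M"
  shows "\<one>\<^bsub>K e\<^esub> \<in> idems T" "psi X R \<one>\<^bsub>K e\<^esub> = e"
proof -
  obtain t where t: "t \<in> carrier T" "psi X R t = e"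
    using assms by (meson idems_closed psi_surj)
  then have "psi X R (sinv T t \<odot> t) = e"
    using assms by (simp add: M.sinv_idem idems_idem)
  then show "\<one>\<^bsub>K e\<^esub> \<in> idems T" "psi X R \<one>\<^bsub>K e\<^esub> = e"
    using K_one_eq[of "sinv T t \<odot> t" e] t by (simp_all add: T.sinv_mult_idem)
qed

text \<open>Both products are idempotents over \<open>e\<close>, and \<open>psi\<close> separates
  idempotents. Thus \<open>sinv\<close> of T restricts to the inverse of the group
  \<open>K e\<close>.\<close>

lemma K_one_mult_sinv:
  assumes "e \<in> idems M" "k \<in> carrier (K e)"
  shows "\<one>\<^bsub>K e\<^esub> = k \<odot> sinv T k" "\<one>\<^bsub>K e\<^esub> = sinv T k \<odot> k"
  using assms by (auto simp: K_carrier_iff M.sinv_idem idems_idem T.mult_sinv_idem T.sinv_mult_idem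
      intro!: K_one_eq)

lemma group_K:
  assumes "e \<in> idems M"
  shows "group (K e)"
proof (rule groupI)
  fix k assume k: "k \<in> carrier (K e)"
  show "\<one>\<^bsub>K e\<^esub> \<otimes>\<^bsub>K e\<^esub> k = k"
    using k unfolding K_one_mult_sinv(1)[OF assms k]
    by (simp add: K_mult K_carrier_iff T.m_assoc T.sinv_simps)
  show "\<exists>l\<in>carrier (K e). l \<otimes>\<^bsub>K e\<^esub> k = \<one>\<^bsub>K e\<^esub>"
    using k K_one_mult_sinv(2)[OF assms k] assms
    by (intro bexI[of _ "sinv T k"]) (auto simp: K_mult K_carrier_iff M.sinv_idem)
qed (use assms K_one_idem in \<open>auto simp: K_carrier_iff K_mult idems_idem idems_closed T.m_assoc\<close>)

lemma inv_K:
  assumes "e \<in> idems M" "k \<in> carrier (K e)"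
  shows "inv\<^bsub>K e\<^esub> k = sinv T k"
  using assms K_one_mult_sinv(2)[OF assms]
  by (intro group.inv_equality[OF group_K]) (auto simp: K_mult K_carrier_iff M.sinv_idem)

lemma K_derived_normal: "e \<in> idems M \<Longrightarrow> derived (K e) (carrier (K e)) \<lhd> K e"
  by (rule group.derived_self_is_normal[OF group_K])

lemma comm_group_K_ab: "e \<in> idems M \<Longrightarrow> comm_group (abelianization (K e))"
  unfolding abelianization_def by (rule group.derived_quot_is_comm_group[OF group_K])

lemma ab_class_hom: "e \<in> idems M \<Longrightarrow> ab_class (K e) \<in> hom (K e) (abelianization (K e))"
  using normal.r_coset_hom_Mod[OF K_derived_normal]
  by (simp add: ab_class_def[abs_def] abelianization_def)

lemma ab_class_elem:
  assumes "C \<in> carrier (abelianization (K e))"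
  obtains k where "k \<in> carrier (K e)" "C = ab_class (K e) k"
  using assms by (auto simp: abelianization_def carrier_FactGroup ab_class_def)


section \<open>Cycles\<close>

abbreviation H :: "'x fim_elem set \<Rightarrow> ('x \<times> 'x fim_elem set \<Rightarrow>\<^sub>0 int) monoid" where
  "H \<equiv> fib (sch_homology_module X R)"

lemma H_carrier_iff:
  "c \<in> carrier (H e) \<longleftrightarrow> Poly_Mapping.keys c \<subseteq> comp_edges X R e \<and> sch_boundary X R c = 0"
  by (simp add: sch_homology_module_def kernel_lmodule_def kernel_def C1_module_def C0_module_def Let_def)

lemma H_mult: "a \<otimes>\<^bsub>H e\<^esub> b = a + b"
  by (simp add: sch_homology_module_def kernel_lmodule_def C1_module_def Let_def)

lemma H_one: "\<one>\<^bsub>H e\<^esub> = 0"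
  by (simp add: sch_homology_module_def kernel_lmodule_def C1_module_def Let_def)

lemma comm_group_H: "comm_group (H e)"
proof (rule comm_groupI)
  fix c assume c: "c \<in> carrier (H e)"
  show "\<exists>d\<in>carrier (H e). d \<otimes>\<^bsub>H e\<^esub> c = \<one>\<^bsub>H e\<^esub>"
    using c by (intro bexI[of _ "- c"]) (auto simp: H_carrier_iff H_mult H_one sch_boundary_minus)
next
  fix c d assume "c \<in> carrier (H e)" "d \<in> carrier (H e)"
  then show "c \<otimes>\<^bsub>H e\<^esub> d \<in> carrier (H e)"
    using keys_add[of c d] by (auto simp: H_carrier_iff H_mult sch_boundary_add)
qed (auto simp: H_carrier_iff H_mult H_one sch_boundary_def)

lemma H_inv: "c \<in> carrier (H e) \<Longrightarrow> inv\<^bsub>H e\<^esub> c = - c"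
  by (rule group.inv_equality) (auto simp: comm_group_H comm_group.axioms(2) H_mult H_one H_carrier_iff sch_boundary_minus)

lemma K_defined_at:
  "\<lbrakk>e \<in> idems M; k \<in> carrier (K e)\<rbrakk> \<Longrightarrow> defined_at M (psi X R k) e"
  by (simp add: K_carrier_iff M.defined_at_idem_iff idems_closed idems_idem)

text \<open>Every element of \<open>K e\<close> leads from the vertex \<open>e\<close> back to
  \<open>e\<close>, so the twist in the crossed homomorphism rule disappears there.\<close>

lemma elem_chain_hom:
  assumes e: "e \<in> idems M"
  shows "(\<lambda>k. elem_chain k e) \<in> hom (K e) (H e)"
proof (rule homI)
  fix k l assume k: "k \<in> carrier (K e)" and l: "l \<in> carrier (K e)"
  have "Poly_Mapping.keys (elem_chain k e) \<subseteq> comp_edges X R e"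
    using e k by (intro elem_chain_keys K_defined_at)
      (auto simp: K_carrier_iff M.sinv_idem idems_idem M.defined_at_idem_iff idems_closed)
  moreover have "sch_boundary X R (elem_chain k e) = 0"
    using e k sch_boundary_elem_chain[OF _ K_defined_at[OF e k]] by (simp add: K_carrier_iff idems_idem)
  ultimately show "elem_chain k e \<in> carrier (H e)"
    by (simp add: H_carrier_iff)
  show "elem_chain (k \<otimes>\<^bsub>K e\<^esub> l) e = elem_chain k e \<otimes>\<^bsub>H e\<^esub> elem_chain l e"
    using e k l elem_chain_mult[of k l e]
    by (simp add: K_carrier_iff K_mult H_mult idems_idem M.defined_at_idem_iff idems_closed)
qed

text \<open>The choice is not normalised: \<open>sec e\<close> need not be the empty word. Closing
  up a loop at \<open>e\<close> therefore conjugates it, which is harmless after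
  abelianization.\<close>

definition sec :: "'x fim_elem set \<Rightarrow> 'x word" where
  "sec m = (SOME w. w \<in> W \<and> ev w = m)"

lemma sec_props:
  assumes "m \<in> carrier M"
  shows "sec m \<in> W" "ev (sec m) = m"
proof -
  obtain w where "w \<in> W \<and> ev w = m"
    using assms by (metis ev_surj)
  then have "sec m \<in> W \<and> ev (sec m) = m"
    unfolding sec_def by (rule someI)
  then show "sec m \<in> W" "ev (sec m) = m"
    by auto
qed

text \<open>The word \<open>sec s\<close> labels a path from \<open>s\<^sup>-\<^sup>1 s\<close> to \<open>s\<close>, so that \<open>loop_word w s\<close> closes up the path
  from \<open>s\<close> labelled \<open>w\<close>.\<close>

definition loop_word :: "'x word \<Rightarrow> 'x fim_elem set \<Rightarrow> 'x word" where
  "loop_word w s = word_inv (sec (ev w \<cdot> s)) @ w @ sec s"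

lemma loop_word_closed: "\<lbrakk>w \<in> W; s \<in> carrier M\<rbrakk> \<Longrightarrow> loop_word w s \<in> W"
  by (simp add: loop_word_def sec_props)

lemma loop_word_K:
  assumes "w \<in> W" "defined_at M (ev w) s" "sinv M s \<cdot> s = e"
  shows "tv (loop_word w s) \<in> carrier (K e)"
proof -
  have s: "s \<in> carrier M"
    using assms by (simp add: defined_at_def)
  have "ev (loop_word w s) = sinv M (ev w \<cdot> s) \<cdot> (ev w \<cdot> s)"
    using assms(1) s by (simp add: loop_word_def ev_append ev_word_inv sec_props)
  also have "\<dots> = e"
    using assms by (simp add: M.defined_at_same_source)
  finally show ?thesis
    using assms(1) s by (simp add: K_carrier_iff loop_word_closed)
qed

lemma loop_word_append:
  assumes "u \<in> W" "v \<in> W" "s \<in> carrier M"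
  shows "tv (loop_word (u @ v) s) = tv (loop_word u (ev v \<cdot> s)) \<odot> tv (loop_word v s)"
proof -
  define A B C where "A = sec (ev u \<cdot> (ev v \<cdot> s))" and "B = sec (ev v \<cdot> s)" and "C = sec s"
  have w: "A \<in> W" "B \<in> W" "C \<in> W" and ev: "ev B = ev v \<cdot> s" "ev C = s"
    using assms by (simp_all add: A_def B_def C_def sec_props)
  \<comment> \<open>In the product of the two loops \<open>B\<close> and its inverse meet. They are
    absorbed by the path \<open>v C\<close>, which has the same image in M as
    \<open>B\<close>.\<close>
  have "tv B \<odot> (sinv T (tv B) \<odot> (tv v \<odot> tv C)) = tv v \<odot> tv C"
    using assms w ev by (intro psi_eq_range_absorb) simp_all
  then show ?thesis
    using assms w
    by (simp add: loop_word_def tv_append tv_word_inv ev_append M.m_assoc T.m_assoc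
        flip: A_def B_def C_def)
qed

lemma loop_word_word_inv:
  assumes "w \<in> W" "defined_at M (ev w) s"
  shows "tv (loop_word (word_inv w) (ev w \<cdot> s)) = sinv T (tv (loop_word w s))"
proof -
  have s: "s \<in> carrier M"
    using assms by (simp add: defined_at_def)
  have "loop_word (word_inv w) (ev w \<cdot> s) = word_inv (loop_word w s)"
    using assms by (simp add: loop_word_def ev_word_inv defined_at_def)
  then show ?thesis
    using assms s by (simp add: tv_word_inv loop_word_closed)
qed

lemma loop_word_Nil:
  assumes "s \<in> carrier M" "sinv M s \<cdot> s = e"
  shows "tv (loop_word [] s) = \<one>\<^bsub>K e\<^esub>"
proof -
  have "tv (loop_word [] s) = sinv T (tv (sec s)) \<odot> tv (sec s)"
    using assms by (simp add: loop_word_def tv_append tv_word_inv sec_props)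
  then show ?thesis
    using assms by (intro K_one_eq[symmetric]) (simp_all add: T.sinv_mult_idem sec_props)
qed

text \<open>The homomorphism \<open>\<kappa>\<close> sending an edge to the class of the loop through it sends the chain of
  a loop \<open>k\<close> at \<open>e\<close> to the class of a conjugate of \<open>k\<close>, because the connecting paths cancel.\<close>

lemma elem_chain_inj:
  assumes e: "e \<in> idems M" and k: "k \<in> carrier (K e)" and zero: "elem_chain k e = 0"
  shows "k \<in> derived (K e) (carrier (K e))"
proof -
  interpret K: group "K e"
    by (rule group_K[OF e])
  interpret A: comm_group "abelianization (K e)"
    by (rule comm_group_K_ab[OF e])
  interpret q: group_hom "K e" "abelianization (K e)" "ab_class (K e)"
    by unfold_locales (rule ab_class_hom[OF e])
  let ?q = "ab_class (K e)" and ?G = "free_Abelian_group (comp_edges X R e)"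
  have "(\<lambda>(x, s). ?q (tv (loop_word [Inl x] s))) ` comp_edges X R e \<subseteq> carrier (abelianization (K e))"
  proof clarify
    fix x s assume "(x, s) \<in> comp_edges X R e"
    then show "?q (tv (loop_word [Inl x] s)) \<in> carrier (abelianization (K e))"
      by (intro q.hom_closed loop_word_K) (simp_all add: comp_edges_iff)
  qed
  then obtain \<kappa> where \<kappa>: "\<kappa> \<in> hom ?G (abelianization (K e))"
    and \<kappa>_edge': "\<And>d. d \<in> comp_edges X R e \<Longrightarrow> \<kappa> (frag_of d) = (\<lambda>(x, s). ?q (tv (loop_word [Inl x] s))) d"
    by (rule A.free_Abelian_group_universal) blast
  have \<kappa>_edge: "\<kappa> (frag_of (x, s)) = ?q (tv (loop_word [Inl x] s))" if "(x, s) \<in> comp_edges X R e" for x s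
    using \<kappa>_edge'[OF that] by simp
  interpret \<kappa>: group_hom ?G "abelianization (K e)" \<kappa>
    by (simp add: group_hom_def group_hom_axioms_def \<kappa>)
  have \<kappa>_add: "\<kappa> (a + b) = \<kappa> a \<otimes>\<^bsub>abelianization (K e)\<^esub> \<kappa> b"
    if "Poly_Mapping.keys a \<subseteq> comp_edges X R e" "Poly_Mapping.keys b \<subseteq> comp_edges X R e" for a b
    using that \<kappa>.hom_mult[of a b] by simp
  \<comment> \<open>Stated for paths that need not be closed, since the induction removes the last
    step of the path.\<close>
  have \<kappa>_path: "\<kappa> (path_chain w s) = ?q (tv (loop_word w s))"
    if "w \<in> W" "defined_at M (ev w) s" "sinv M s \<cdot> s = e" for w s
    using that
  proof (induction w)
    case Nil
    then show ?case
      using \<kappa>.hom_one by (simp add: loop_word_Nil defined_at_def)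
  next
    case (Cons a w)
    have aw: "a \<in> X <+> X" "w \<in> W" "[a] \<in> W"
      using Cons.prems by simp_all
    have s: "s \<in> carrier M"
      using Cons.prems by (simp add: defined_at_def)
    have d: "defined_at M (ev w) s" "defined_at M (ev [a]) (ev w \<cdot> s)"
      using Cons.prems aw by (simp_all add: ev_Cons[of a w] M.defined_at_mult_iff)
    define r where "r = ev w \<cdot> s"
    have r: "r \<in> carrier M" "sinv M r \<cdot> r = e"
      using aw d s Cons.prems(3) by (simp_all add: r_def M.defined_at_same_source)
    have letter: "\<kappa> (letter_chain a r) = ?q (tv (loop_word [a] r))"
    proof (cases a)
      case (Inl x)
      then have "(x, r) \<in> comp_edges X R e"
        using aw d r by (simp add: comp_edges_iff flip: r_def)
      then show ?thesis
        using Inl by (simp add: letter_chain_def \<kappa>_edge)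
    next
      case (Inr x)
      then have x: "x \<in> X" "[Inl x] \<in> W"
        using aw by simp_all
      \<comment> \<open>The step from \<open>r\<close> to \<open>p\<close> runs backwards through
        the edge from \<open>p\<close> to \<open>r\<close>, so its loop is the inverse of the loop
        of that edge.\<close>
      define p where "p = ev [Inr x] \<cdot> r"
      have p: "defined_at M (ev [Inl x]) p" "sinv M p \<cdot> p = e" "ev [Inl x] \<cdot> p = r"
        using x d(2) Inr r M.defined_at_sinv[OF _ d(2)]
        by (simp_all add: p_def ev_Inr M.defined_at_same_source flip: r_def)
          (simp add: defined_at_def)
      then have edge: "(x, p) \<in> comp_edges X R e"
        using x by (simp add: comp_edges_iff)
      have K: "tv (loop_word [Inl x] p) \<in> carrier (K e)"
        using x p by (intro loop_word_K)
      have "\<kappa> (- frag_of (x, p)) = inv\<^bsub>abelianization (K e)\<^esub> \<kappa> (frag_of (x, p))"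
        using edge \<kappa>.hom_inv[of "frag_of (x, p)"] by simp
      also have "\<dots> = ?q (sinv T (tv (loop_word [Inl x] p)))"
        using K edge by (simp add: \<kappa>_edge inv_K[OF e] flip: q.hom_inv)
      also have "sinv T (tv (loop_word [Inl x] p)) = tv (loop_word [Inr x] r)"
        using loop_word_word_inv[OF x(2) p(1)] p(3) by (simp add: word_inv_def)
      finally show ?thesis
        using Inr by (simp add: letter_chain_def p_def)
    qed
    have "Poly_Mapping.keys (path_chain w s) \<subseteq> comp_edges X R e"
      using aw d Cons.prems(3) by (intro path_chain_keys)
    moreover have "Poly_Mapping.keys (letter_chain a r) \<subseteq> comp_edges X R e"
      using aw d(2) r path_chain_keys[of "[a]" r e] by (simp flip: r_def)
    ultimately have "\<kappa> (path_chain (a # w) s) = \<kappa> (path_chain w s) \<otimes>\<^bsub>abelianization (K e)\<^esub> \<kappa> (letter_chain a r)"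
      using r by (simp add: \<kappa>_add flip: r_def)
    \<comment> \<open>The chain lists the steps in the order in which they are walked, whereas the
      product of loops has the last step on the left. Reversing the order is possible because the
      target is abelian.\<close>
    also have "\<dots> = \<kappa> (letter_chain a r) \<otimes>\<^bsub>abelianization (K e)\<^esub> \<kappa> (path_chain w s)"
    proof (rule A.m_comm)
      show "\<kappa> (path_chain w s) \<in> carrier (abelianization (K e))"
        using Cons.IH aw d Cons.prems(3) by (simp add: loop_word_K)
      show "\<kappa> (letter_chain a r) \<in> carrier (abelianization (K e))"
        using letter aw d r by (simp add: loop_word_K flip: r_def)
    qed
    also have "\<dots> = ?q (tv (loop_word [a] r) \<otimes>\<^bsub>K e\<^esub> tv (loop_word w s))"
      using letter Cons.IH aw d r Cons.prems(3) by (simp add: loop_word_K flip: r_def)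
    also have "\<dots> = ?q (tv (loop_word (a # w) s))"
      using loop_word_append[OF aw(3,2) s] by (simp add: K_mult r_def)
    finally show ?case .
  qed
  obtain w where w: "w \<in> W" "k = tv w"
    using k by (metis K_carrier_iff tv_surj)
  have ee: "e \<in> carrier M" "sinv M e \<cdot> e = e" "ev w = e"
    using e k w by (simp_all add: idems_closed M.sinv_idem idems_idem K_carrier_iff)
  have d: "defined_at M (ev w) e"
    using K_defined_at[OF e k] w by simp
  \<comment> \<open>The conjugating element itself lies in \<open>K e\<close>, hence it cancels in
    the abelianization.\<close>
  have z: "tv (sec e) \<in> carrier (K e)"
    using ee by (simp add: K_carrier_iff sec_props)
  have "\<kappa> (path_chain w e) = \<one>\<^bsub>abelianization (K e)\<^esub>"
    using zero w d \<kappa>.hom_one by (simp add: elem_chain_tv)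
  moreover have "tv (loop_word w e) = inv\<^bsub>K e\<^esub> tv (sec e) \<otimes>\<^bsub>K e\<^esub> (k \<otimes>\<^bsub>K e\<^esub> tv (sec e))"
    using w ee idems_idem[OF e] by (simp add: inv_K[OF e z] K_mult loop_word_def tv_append tv_word_inv sec_props)
  ultimately have "?q (inv\<^bsub>K e\<^esub> tv (sec e) \<otimes>\<^bsub>K e\<^esub> (k \<otimes>\<^bsub>K e\<^esub> tv (sec e))) = \<one>\<^bsub>abelianization (K e)\<^esub>"
    using \<kappa>_path[OF w(1) d ee(2)] by simp
  then have "inv\<^bsub>abelianization (K e)\<^esub> ?q (tv (sec e)) \<otimes>\<^bsub>abelianization (K e)\<^esub>
      (?q k \<otimes>\<^bsub>abelianization (K e)\<^esub> ?q (tv (sec e))) = \<one>\<^bsub>abelianization (K e)\<^esub>"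
    using k z by simp
  then have "?q k = \<one>\<^bsub>abelianization (K e)\<^esub>"
    using k z by (simp add: A.m_comm[of "?q k"] A.inv_solve_left' flip: A.m_assoc)
  then have "derived (K e) (carrier (K e)) #>\<^bsub>K e\<^esub> k = derived (K e) (carrier (K e))"
    by (simp add: ab_class_def abelianization_def)
  then show ?thesis
    by (rule K.coset_join1[OF _ k K.derived_is_subgroup]) simp
qed

lemma elem_chain_surj:
  assumes e: "e \<in> idems M" and c: "c \<in> carrier (H e)"
  obtains k where "k \<in> carrier (K e)" "elem_chain k e = c"
proof -
  interpret h: group_hom "K e" "H e" "\<lambda>k. elem_chain k e"
    using group_K[OF e] comm_group_H[of e] elem_chain_hom[OF e]
    by (simp add: group_hom_def group_hom_axioms_def comm_group_def)
  \<comment> \<open>Subtracting \<open>\<Gamma> (\<partial> c)\<close> closes up every edge of \<open>c\<close> to a loop at \<open>e\<close>, and does not change cycles.\<close>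
  define \<Gamma> where "\<Gamma> = frag_extend (\<lambda>s. path_chain (sec s) e)"
  have ee: "e \<in> carrier M"
    using e by (rule idems_closed)
  have "Poly_Mapping.keys c \<subseteq> comp_edges X R e" and bd: "sch_boundary X R c = 0"
    using c by (simp_all add: H_carrier_iff)
  \<comment> \<open>The induction passes through single edges, which need not be cycles, so the
    claim is made for arbitrary chains with a correction that depends additively on the
    chain.\<close>
  from this(1) have "\<exists>k\<in>carrier (K e). elem_chain k e = c - \<Gamma> (sch_boundary X R c)"
  proof (induction rule: frag_induction)
    case zero
    then show ?case
      using h.hom_one by (intro bexI[of _ "\<one>\<^bsub>K e\<^esub>"]) (simp_all add: \<Gamma>_def sch_boundary_def H_one)
  next
    case (one d)
    obtain x s where d: "d = (x, s)"
      by (cases d)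
    have x: "x \<in> X" "[Inl x] \<in> W" and df: "defined_at M (ev [Inl x]) s" and se: "sinv M s \<cdot> s = e"
      using one d by (simp_all add: comp_edges_iff)
    have s: "s \<in> carrier M" "s \<cdot> e = s"
      using df se M.mult_source_idem by (simp_all add: defined_at_def)
    define r where "r = ev [Inl x] \<cdot> s"
    have r: "r \<in> carrier M" "sinv M r \<cdot> r = e" "r \<cdot> e = r"
      using x s df se M.mult_source_idem[of r e] by (simp_all add: r_def M.defined_at_same_source)
    have K: "tv (loop_word [Inl x] s) \<in> carrier (K e)"
      using x df se by (intro loop_word_K)
    have inv: "path_chain (word_inv (sec r)) r = - path_chain (sec r) e"
      using path_chain_word_inv[of "sec r" e] M.defined_at_source[OF r(1,2)] r by (simp add: sec_props)
    have "elem_chain (tv (loop_word [Inl x] s)) e = path_chain (loop_word [Inl x] s) e"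
      using K_defined_at[OF e K] x s by (intro elem_chain_tv) (simp_all add: loop_word_closed)
    also have "\<dots> = path_chain (sec s) e + letter_chain (Inl x) s + path_chain (word_inv (sec r)) r"
      using x s r ee by (simp add: loop_word_def path_chain_append sec_props ev_Cons[of "Inl x" "sec s"] M.m_assoc
          flip: r_def)
    also have "\<dots> = frag_of d - \<Gamma> (sch_boundary X R (frag_of d))"
      by (simp add: inv d \<Gamma>_def sch_boundary_edge frag_extend_diff letter_chain_def flip: r_def)
    finally show ?case
      using K by blast
  next
    case (diff a b)
    then obtain k l where "k \<in> carrier (K e)" "elem_chain k e = a - \<Gamma> (sch_boundary X R a)"
      "l \<in> carrier (K e)" "elem_chain l e = b - \<Gamma> (sch_boundary X R b)"
      by blast
    moreover from this have "elem_chain (inv\<^bsub>K e\<^esub> l) e = - elem_chain l e"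
      using h.hom_inv[of l] H_inv[OF h.hom_closed[of l]] by metis
    ultimately show ?case
      using h.hom_mult[of k "inv\<^bsub>K e\<^esub> l"]
      by (intro bexI[of _ "k \<otimes>\<^bsub>K e\<^esub> inv\<^bsub>K e\<^esub> l"])
        (simp_all add: H_mult sch_boundary_diff \<Gamma>_def frag_extend_diff)
  qed
  then show thesis
    using that by (auto simp: bd \<Gamma>_def)
qed

text \<open>Written in the form of the map in \<open>FactGroup_iso_set\<close>, so that the first
  isomorphism theorem applies as it stands.\<close>

definition phi :: "'x fim_elem set \<Rightarrow> 'x fim_elem set set \<Rightarrow> 'x \<times> 'x fim_elem set \<Rightarrow>\<^sub>0 int" where
  "phi e C = the_elem ((\<lambda>k. elem_chain k e) ` C)"

text \<open>One inclusion is \<open>elem_chain_inj\<close>; the other holds because the group of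
  cycles is abelian.\<close>

lemma kernel_elem_chain:
  assumes e: "e \<in> idems M"
  shows "kernel (K e) (H e) (\<lambda>k. elem_chain k e) = derived (K e) (carrier (K e))"
proof
  interpret K: group "K e"
    by (rule group_K[OF e])
  interpret h: group_hom "K e" "H e" "\<lambda>k. elem_chain k e"
    using group_K[OF e] comm_group_H[of e] elem_chain_hom[OF e]
    by (simp add: group_hom_def group_hom_axioms_def comm_group_def)
  show "kernel (K e) (H e) (\<lambda>k. elem_chain k e) \<subseteq> derived (K e) (carrier (K e))"
    using elem_chain_inj[OF e] by (auto simp: kernel_def H_one)
  have "(\<lambda>k. elem_chain k e) ` derived (K e) (carrier (K e)) = {\<one>\<^bsub>H e\<^esub>}"
    using h.derived_img[of "carrier (K e)"] h.hom_closed
      comm_group.derived_eq_singleton[OF comm_group_H, of "(\<lambda>k. elem_chain k e) ` carrier (K e)" e]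
    by (metis image_subsetI order_refl)
  then show "derived (K e) (carrier (K e)) \<subseteq> kernel (K e) (H e) (\<lambda>k. elem_chain k e)"
    using K.derived_in_carrier[of "carrier (K e)"] by (auto simp: kernel_def)
qed

lemma phi_iso:
  assumes e: "e \<in> idems M"
  shows "phi e \<in> iso (abelianization (K e)) (H e)"
proof -
  interpret h: group_hom "K e" "H e" "\<lambda>k. elem_chain k e"
    using group_K[OF e] comm_group_H[of e] elem_chain_hom[OF e]
    by (simp add: group_hom_def group_hom_axioms_def comm_group_def)
  have "(\<lambda>k. elem_chain k e) ` carrier (K e) = carrier (H e)"
    using h.hom_closed elem_chain_surj[OF e] by blast
  then show ?thesis
    using h.FactGroup_iso_set by (simp add: phi_def[abs_def] abelianization_def kernel_elem_chain[OF e])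
qed

lemma phi_eq:
  assumes e: "e \<in> idems M" and C: "C \<in> carrier (abelianization (K e))" and k: "k \<in> C"
  shows "k \<in> carrier (K e)" "phi e C = elem_chain k e" "ab_class (K e) k = C"
proof -
  interpret K: group "K e"
    by (rule group_K[OF e])
  interpret h: group_hom "K e" "H e" "\<lambda>k. elem_chain k e"
    using group_K[OF e] comm_group_H[of e] elem_chain_hom[OF e]
    by (simp add: group_hom_def group_hom_axioms_def comm_group_def)
  obtain l where l: "l \<in> carrier (K e)" "C = ab_class (K e) l"
    using C by (rule ab_class_elem)
  have D: "subgroup (derived (K e) (carrier (K e))) (K e)"
    by (rule K.derived_is_subgroup) simp
  show "ab_class (K e) k = C"
    using k l D K.repr_independence by (auto simp: ab_class_def)
  have mem: "j \<in> carrier (K e) \<and> elem_chain j e = elem_chain l e" if j: "j \<in> C" for j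
  proof -
    obtain d where d: "d \<in> derived (K e) (carrier (K e))" "j = d \<otimes>\<^bsub>K e\<^esub> l"
      using j unfolding l(2) ab_class_def r_coset_def by blast
    then have "d \<in> carrier (K e)" "elem_chain d e = 0"
      using kernel_elem_chain[OF e] by (auto simp: kernel_def H_one)
    then show ?thesis
      using d l by (simp add: H_mult)
  qed
  then have "(\<lambda>j. elem_chain j e) ` C = {elem_chain k e}"
    using k by auto
  then show "k \<in> carrier (K e)" "phi e C = elem_chain k e"
    using mem k by (auto simp: phi_def)
qed

end

section \<open>Transport of the module structure\<close>

text \<open>Every equation in \<open>B\<close> is verified after applying \<phi>. Injectivity of
  \<phi> speaks only about elements of the fibres, so closure of \<open>res\<close> and
  \<open>act\<close> has to be supplied beforehand.\<close>

lemma (in lausch_module) transport: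
  assumes iso: "lmodule_iso M B A \<phi>"
    and fib: "\<And>e. e \<in> idems M \<Longrightarrow> comm_group (fib B e)"
    and res: "\<And>e f b. \<lbrakk>e \<in> idems M; f \<in> idems M; nat_le M f e; b \<in> carrier (fib B e)\<rbrakk>
      \<Longrightarrow> res B e f b \<in> carrier (fib B f)"
    and act: "\<And>p s. \<lbrakk>p \<in> total M B; s \<in> carrier M\<rbrakk> \<Longrightarrow> act B p s \<in> total M B"
  shows "lausch_module M B"
proof -
  have \<phi>: "\<phi> e \<in> iso (fib B e) (fib A e)" if "e \<in> idems M" for e
    using iso that by (simp add: lmodule_iso_def)
  have res_\<phi>: "\<phi> f (res B e f b) = res A e f (\<phi> e b)"
    if "e \<in> idems M" "f \<in> idems M" "nat_le M f e" "b \<in> carrier (fib B e)" for e f b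
    using iso that by (simp add: lmodule_iso_def)
  have act_\<phi>: "total_map \<phi> (act B p s) = act A (total_map \<phi> p) s" if "p \<in> total M B" "s \<in> carrier M" for p s
    using iso that by (simp add: lmodule_iso_def)
  have closed: "\<phi> e b \<in> carrier (fib A e)" if "e \<in> idems M" "b \<in> carrier (fib B e)" for e b
    using \<phi>[OF that(1)] that(2) by (auto simp: iso_def hom_def)
  have mult: "\<phi> e (b \<otimes>\<^bsub>fib B e\<^esub> c) = \<phi> e b \<otimes>\<^bsub>fib A e\<^esub> \<phi> e c"
    if "e \<in> idems M" "b \<in> carrier (fib B e)" "c \<in> carrier (fib B e)" for e b c
    using \<phi>[OF that(1)] that(2,3) by (auto simp: iso_def hom_def)
  have one: "\<phi> e \<one>\<^bsub>fib B e\<^esub> = \<one>\<^bsub>fib A e\<^esub>" if "e \<in> idems M" for e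
    using hom_one[of "\<phi> e" "fib B e" "fib A e"] \<phi>[OF that] fib[OF that] fib_comm_group[OF that]
    by (simp add: iso_def comm_group_def)
  have inj: "b = c" if "e \<in> idems M" "b \<in> carrier (fib B e)" "c \<in> carrier (fib B e)" "\<phi> e b = \<phi> e c" for e b c
    using \<phi>[OF that(1)] that(2-4) by (auto simp: iso_def bij_betw_def inj_on_def)
  have total_inj: "p = q" if "p \<in> total M B" "q \<in> total M B" "total_map \<phi> p = total_map \<phi> q" for p q
    using that inj by (cases p; cases q) (auto simp: total_def total_map_def)
  have total_closed: "total_map \<phi> p \<in> total M A" if "p \<in> total M B" for p
    using that closed by (cases p) (auto simp: total_def total_map_def)
  have le: "nat_le M (e \<otimes> f) e" "nat_le M (e \<otimes> f) f" if "e \<in> idems M" "f \<in> idems M" for e f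
    using that idems_left_comm[of f e f]
    by (simp_all add: nat_le_idem_iff idems_mult idems_left_idem idems_closed idems_idem)
  have oplus: "oplus M B p q \<in> total M B \<and> total_map \<phi> (oplus M B p q) = oplus M A (total_map \<phi> p) (total_map \<phi> q)"
    if pq: "p \<in> total M B" "q \<in> total M B" for p q
  proof -
    obtain e b f c where p: "p = (e, b)" "e \<in> idems M" "b \<in> carrier (fib B e)"
      and q: "q = (f, c)" "f \<in> idems M" "c \<in> carrier (fib B f)"
      using pq by (auto simp: total_def)
    have ef: "e \<otimes> f \<in> idems M"
      using p q by (intro idems_mult)
    interpret g: comm_group "fib B (e \<otimes> f)"
      by (rule fib[OF ef])
    have "res B e (e \<otimes> f) b \<in> carrier (fib B (e \<otimes> f))" "res B f (e \<otimes> f) c \<in> carrier (fib B (e \<otimes> f))"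
      using p q ef le by (simp_all add: res)
    then show ?thesis
      using p q ef le by (simp add: oplus_def total_map_def total_def mult res_\<phi>)
  qed
  have zero: "zero_at B e \<in> total M B \<and> total_map \<phi> (zero_at B e) = zero_at A e" if "e \<in> idems M" for e
    using that one fib[OF that] comm_group.axioms(2) group.is_monoid monoid.one_closed
    by (fastforce simp: zero_at_def total_def total_map_def)
  show ?thesis
  proof (intro lausch_module.intro lausch_module_axioms.intro inverse_monoid_axioms)
    fix e f assume ef: "e \<in> idems M" "f \<in> idems M" "nat_le M f e"
    show "res B e f \<in> hom (fib B e) (fib B f)"
    proof (rule homI)
      fix b c assume bc: "b \<in> carrier (fib B e)" "c \<in> carrier (fib B e)"
      interpret e: comm_group "fib B e" by (rule fib) fact
      interpret f: comm_group "fib B f" by (rule fib) fact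
      have "\<phi> f (res B e f (b \<otimes>\<^bsub>fib B e\<^esub> c)) = \<phi> f (res B e f b \<otimes>\<^bsub>fib B f\<^esub> res B e f c)"
        using ef bc hom_mult[OF res_hom[OF ef]] by (simp add: res_\<phi> mult closed res)
      then show "res B e f (b \<otimes>\<^bsub>fib B e\<^esub> c) = res B e f b \<otimes>\<^bsub>fib B f\<^esub> res B e f c"
        using ef bc by (intro inj[OF ef(2)]) (auto intro: res)
    qed (use ef res in auto)
  next
    fix e b assume *: "e \<in> idems M" "b \<in> carrier (fib B e)"
    then have le: "nat_le M e e"
      by (simp add: nat_le_idem_iff idems_idem)
    then show "res B e e b = b"
      using * by (intro inj[OF *(1)]) (simp_all add: res_\<phi> res_id closed res)
  next
    fix e f g b
    assume *: "e \<in> idems M" "f \<in> idems M" "g \<in> idems M" "nat_le M f e" "nat_le M g f" "b \<in> carrier (fib B e)"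
    have "e \<otimes> f = f" "f \<otimes> g = g"
      using * by (simp_all add: nat_le_idem_iff)
    then have "e \<otimes> g = g"
      using * m_assoc[of e f g] by (simp add: idems_closed)
    then have "nat_le M g e"
      using * by (simp add: nat_le_idem_iff)
    then show "res B f g (res B e f b) = res B e g b"
      using * by (intro inj[OF *(3)]) (simp_all add: res_\<phi> res_comp closed res)
  next
    fix p q s assume *: "p \<in> total M B" "q \<in> total M B" "s \<in> carrier M"
    then show "act B (oplus M B p q) s = oplus M B (act B p s) (act B q s)"
      by (intro total_inj) (simp_all add: act oplus act_\<phi> act_oplus total_closed)
  next
    fix p s t assume *: "p \<in> total M B" "s \<in> carrier M" "t \<in> carrier M"
    then show "act B p (s \<otimes> t) = act B (act B p s) t"
      by (intro total_inj) (simp_all add: act act_\<phi> act_mult total_closed)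
  next
    fix p e assume *: "p \<in> total M B" "e \<in> idems M"
    then show "act B p e = oplus M B p (zero_at B e)"
      by (intro total_inj) (simp_all add: act act_\<phi> act_idem oplus zero total_closed idems_closed)
  next
    fix e s assume *: "e \<in> idems M" "s \<in> carrier M"
    then show "act B (zero_at B e) s = zero_at B (sinv M s \<otimes> e \<otimes> s)"
      by (intro total_inj) (simp_all add: act act_\<phi> act_zero zero conj_idem)
  qed (use fib act in auto)
qed

context presentation
begin

section \<open>The homology module\<close>

lemma comp_edges_act:
  assumes "(x, s) \<in> comp_edges X R e" "t \<in> carrier M"
  shows "(x, s \<cdot> t) \<in> comp_edges X R (sinv M t \<cdot> e \<cdot> t)"
proof -
  have "s \<in> carrier M"
    using assms by (simp add: comp_edges_iff defined_at_def)
  then show ?thesis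
    using assms M.conj_source[of s t] M.defined_at_mult_right[of "ev [Inl x]" t s]
    by (simp add: comp_edges_iff)
qed

lemma C1_act_diff: "C1_act X R t (a - b) = C1_act X R t a - C1_act X R t b"
  by (simp add: C1_act_def frag_extend_diff)

lemma C1_act_zero [simp]: "C1_act X R t 0 = 0"
  by (simp add: C1_act_def)

lemma sch_boundary_zero [simp]: "sch_boundary X R 0 = 0"
  by (simp add: sch_boundary_def)

lemma C1_act_mult:
  assumes "Poly_Mapping.keys c \<subseteq> comp_edges X R e" "s \<in> carrier M" "t \<in> carrier M"
  shows "C1_act X R t (C1_act X R s c) = C1_act X R (s \<cdot> t) c"
  using assms(1)
proof (induction rule: frag_induction)
  case (one d)
  then show ?case
    using assms by (cases d) (simp add: C1_act_edge comp_edges_iff defined_at_def M.m_assoc)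
qed (simp_all add: C1_act_diff)

text \<open>A vertex \<open>r\<close> of the component satisfies \<open>r e = r\<close>, so acting
  by \<open>s\<close> there depends only on \<open>e s\<close>. In particular an idempotent
  \<open>f\<close> acts on this fibre as \<open>e f\<close> does, which gives the axiom for
  idempotents.\<close>

lemma C1_act_cong:
  assumes "Poly_Mapping.keys c \<subseteq> comp_edges X R e" "s \<in> carrier M" "t \<in> carrier M" "e \<cdot> s = e \<cdot> t"
  shows "C1_act X R s c = C1_act X R t c"
  using assms(1)
proof (induction rule: frag_induction)
  case (one d)
  obtain x r where d: "d = (x, r)"
    by (cases d)
  then have r: "r \<in> carrier M" "sinv M r \<cdot> r = e" "e \<in> carrier M" "r \<cdot> e = r"
    using one M.mult_source_idem[of r e] by (auto simp: comp_edges_iff defined_at_def)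
  have "r \<cdot> e \<cdot> s = r \<cdot> e \<cdot> t"
    using r(1,3) assms by (simp add: M.m_assoc)
  then show ?case
    by (simp add: d C1_act_edge r(4))
qed (simp_all add: C1_act_diff)

lemma C1_act_idem:
  assumes "e \<in> idems M" "Poly_Mapping.keys c \<subseteq> comp_edges X R e"
  shows "C1_act X R e c = c"
  using assms(2)
proof (induction rule: frag_induction)
  case (one d)
  then show ?case
    using M.mult_source_idem by (cases d) (auto simp: C1_act_edge comp_edges_iff defined_at_def)
qed (simp_all add: C1_act_diff)

lemma C1_act_keys:
  assumes "Poly_Mapping.keys c \<subseteq> comp_edges X R e" "t \<in> carrier M"
  shows "Poly_Mapping.keys (C1_act X R t c) \<subseteq> comp_edges X R (sinv M t \<cdot> e \<cdot> t)"
  using assms(1)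
proof (induction rule: frag_induction)
  case (one d)
  then show ?case
    using comp_edges_act assms(2) by (cases d) (simp add: C1_act_edge)
next
  case (diff a b)
  then show ?case
    using keys_diff[of "C1_act X R t a" "C1_act X R t b"] unfolding C1_act_diff by blast
qed simp

lemma sch_boundary_act:
  assumes "Poly_Mapping.keys c \<subseteq> comp_edges X R e" "t \<in> carrier M"
  shows "sch_boundary X R (C1_act X R t c) = C0_act X R t (sch_boundary X R c)"
  using assms(1)
proof (induction rule: frag_induction)
  case (one d)
  then show ?case
    using assms(2) by (cases d) (simp add: C1_act_edge comp_edges_iff defined_at_def sch_boundary_edge
        C0_act_def frag_extend_diff M.m_assoc)
qed (simp_all add: C1_act_diff sch_boundary_diff C0_act_def frag_extend_diff)

lemma H_act_closed:
  "\<lbrakk>c \<in> carrier (H e); t \<in> carrier M\<rbrakk> \<Longrightarrow> C1_act X R t c \<in> carrier (H (sinv M t \<cdot> e \<cdot> t))"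
  using C1_act_keys[of c e t] sch_boundary_act[of c e t] by (simp add: H_carrier_iff C0_act_def)

lemma H_res: "res (sch_homology_module X R) e f c = C1_act X R f c"
  by (simp add: sch_homology_module_def kernel_lmodule_def C1_module_def Let_def)

lemma H_act: "act (sch_homology_module X R) (e, c) t = (sinv M t \<cdot> e \<cdot> t, C1_act X R t c)"
  by (simp add: sch_homology_module_def kernel_lmodule_def C1_module_def Let_def)

text \<open>Reconciles the fibre in which the action of \<open>f\<close> lands with the fibre in
  which \<open>res\<close> lands.\<close>

lemma conj_of_le:
  assumes "e \<in> idems M" "f \<in> idems M" "nat_le M f e"
  shows "sinv M f \<cdot> e \<cdot> f = f"
  using assms by (simp add: M.sinv_idem M.nat_le_idem_iff M.m_assoc idems_closed idems_idem)

lemma lausch_module_H: "lausch_module M (sch_homology_module X R)"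
proof (intro lausch_module.intro lausch_module_axioms.intro M.inverse_monoid_axioms)
  fix e f assume ef: "e \<in> idems M" "f \<in> idems M" "nat_le M f e"
  show "res (sch_homology_module X R) e f \<in> hom (H e) (H f)"
    using H_act_closed[of _ e f] ef
    by (intro homI) (simp_all add: H_res H_mult C1_act_add conj_of_le idems_closed)
next
  fix e c assume "e \<in> idems M" "c \<in> carrier (H e)"
  then show "res (sch_homology_module X R) e e c = c"
    by (simp add: H_res H_carrier_iff C1_act_idem)
next
  fix e f g c
  assume *: "e \<in> idems M" "f \<in> idems M" "g \<in> idems M" "nat_le M f e" "nat_le M g f" "c \<in> carrier (H e)"
  then have "f \<cdot> g = g"
    by (simp add: M.nat_le_idem_iff)
  then show "res (sch_homology_module X R) f g (res (sch_homology_module X R) e f c) =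
      res (sch_homology_module X R) e g c"
    using * by (simp add: H_res H_carrier_iff C1_act_mult[of c e] idems_closed)
next
  fix p s assume "p \<in> total M (sch_homology_module X R)" "s \<in> carrier M"
  then show "act (sch_homology_module X R) p s \<in> total M (sch_homology_module X R)"
    by (auto simp: total_def H_act M.conj_idem H_act_closed)
next
  fix p q s
  assume pq: "p \<in> total M (sch_homology_module X R)" "q \<in> total M (sch_homology_module X R)"
    and s: "s \<in> carrier M"
  obtain e c f d where p: "p = (e, c)" "e \<in> idems M" "Poly_Mapping.keys c \<subseteq> comp_edges X R e"
    and q: "q = (f, d)" "f \<in> idems M" "Poly_Mapping.keys d \<subseteq> comp_edges X R f"
    using pq by (auto simp: total_def H_carrier_iff)
  have ef: "e \<in> carrier M" "f \<in> carrier M" "e \<cdot> f \<in> idems M"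
    using p q by (auto simp: idems_closed)
  have conj: "sinv M s \<cdot> (e \<cdot> f) \<cdot> s = (sinv M s \<cdot> e \<cdot> s) \<cdot> (sinv M s \<cdot> f \<cdot> s)"
  proof -
    have "(sinv M s \<cdot> e \<cdot> s) \<cdot> (sinv M s \<cdot> f \<cdot> s) = sinv M s \<cdot> e \<cdot> (s \<cdot> (sinv M s \<cdot> f \<cdot> s))"
      using ef s by (simp add: M.m_assoc)
    also have "\<dots> = sinv M s \<cdot> e \<cdot> (f \<cdot> s)"
      using s q(2) by (simp only: M.idem_mult_eq_mult_conj)
    finally show ?thesis
      using ef s by (simp add: M.m_assoc)
  qed
  \<comment> \<open>Restricting to \<open>e f\<close> and then translating by \<open>s\<close> is
    the same as translating first and then restricting to the conjugate of
    \<open>e f\<close>.\<close>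
  have "s \<cdot> (sinv M s \<cdot> (e \<cdot> f) \<cdot> s) = (e \<cdot> f) \<cdot> s"
    using ef s by (simp add: M.idem_mult_eq_mult_conj)
  then have "C1_act X R s (C1_act X R (e \<cdot> f) a) = C1_act X R (sinv M s \<cdot> (e \<cdot> f) \<cdot> s) (C1_act X R s a)"
    if "Poly_Mapping.keys a \<subseteq> comp_edges X R g" for a g
    using that ef s by (simp add: C1_act_mult[of a g] idems_closed)
  then show "act (sch_homology_module X R) (oplus M (sch_homology_module X R) p q) s =
      oplus M (sch_homology_module X R) (act (sch_homology_module X R) p s) (act (sch_homology_module X R) q s)"
    using p q by (simp add: oplus_def H_act H_res H_mult C1_act_add flip: conj)
next
  fix p s t assume *: "p \<in> total M (sch_homology_module X R)" "s \<in> carrier M" "t \<in> carrier M"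
  then obtain e c where "p = (e, c)" "e \<in> idems M" "Poly_Mapping.keys c \<subseteq> comp_edges X R e"
    by (auto simp: total_def H_carrier_iff)
  then show "act (sch_homology_module X R) p (s \<cdot> t) =
      act (sch_homology_module X R) (act (sch_homology_module X R) p s) t"
    using * by (simp add: H_act C1_act_mult[of c e] M.sinv_mult M.m_assoc idems_closed)
next
  fix p f assume *: "p \<in> total M (sch_homology_module X R)" "f \<in> idems M"
  then obtain e c where p: "p = (e, c)" "e \<in> idems M" "Poly_Mapping.keys c \<subseteq> comp_edges X R e"
    by (auto simp: total_def H_carrier_iff)
  have "C1_act X R f c = C1_act X R (e \<cdot> f) c"
    using p * by (intro C1_act_cong[OF p(3)]) (simp_all add: idems_closed M.idems_left_idem)
  moreover have "sinv M f \<cdot> e \<cdot> f = e \<cdot> f"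
    using p * M.idems_comm[of e f] by (simp add: M.sinv_idem M.m_assoc idems_closed M.idems_left_idem)
  ultimately show "act (sch_homology_module X R) p f =
      oplus M (sch_homology_module X R) p (zero_at (sch_homology_module X R) f)"
    using p by (simp add: H_act oplus_def zero_at_def H_res H_mult H_one)
qed (simp_all add: comm_group_H H_act zero_at_def H_one)


section \<open>The relation module\<close>

text \<open>From \<open>f\<close> the path follows \<open>t\<close> to the vertex
  \<open>e m\<close>, where m is the image of \<open>t\<close>, runs there through the translate of
  the loop \<open>k\<close> by m, and returns along the inverse of \<open>t\<close>. The way out and
  the way back cancel.\<close>

lemma elem_chain_conj:
  assumes e: "e \<in> idems M" and k: "k \<in> carrier (K e)" and t: "t \<in> carrier T" and f: "f = sinv M (psi X R t) \<cdot> e \<cdot> psi X R t"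
  shows "sinv T t \<odot> k \<odot> t \<in> carrier (K f)"
    and "elem_chain (sinv T t \<odot> k \<odot> t) f = C1_act X R (psi X R t) (elem_chain k e)"
proof -
  let ?m = "psi X R t"
  have k': "k \<in> carrier T" "psi X R k = e"
    using k by (simp_all add: K_carrier_iff)
  have c: "e \<in> carrier M" "?m \<in> carrier M" "f \<in> idems M" "f \<in> carrier M"
    using e t f by (simp_all add: idems_closed M.conj_idem)
  show K: "sinv T t \<odot> k \<odot> t \<in> carrier (K f)"
    using t k' f by (simp add: K_carrier_iff)
  have mf: "?m \<cdot> f = e \<cdot> ?m"
    using e t f by (simp add: M.idem_mult_eq_mult_conj)
  have em: "e \<cdot> (e \<cdot> ?m) = e \<cdot> ?m"
    using e c by (simp add: M.idems_left_idem)
  have d1: "defined_at M (psi X R (sinv T t \<odot> k) \<cdot> ?m) f"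
    using K_defined_at[OF c(3) K] t k' by simp
  then have d2: "defined_at M (sinv M ?m \<cdot> psi X R k) (?m \<cdot> f)" "defined_at M ?m f"
    using t k' c by (simp_all add: M.defined_at_mult_iff)
  have "elem_chain (sinv T t \<odot> k \<odot> t) f = elem_chain t f + elem_chain (sinv T t \<odot> k) (?m \<cdot> f)"
    using t k' d1 by (intro elem_chain_mult) simp_all
  also have "elem_chain (sinv T t \<odot> k) (?m \<cdot> f) = elem_chain k (?m \<cdot> f) + elem_chain (sinv T t) (e \<cdot> (?m \<cdot> f))"
    using elem_chain_mult[of "sinv T t" k "?m \<cdot> f"] t k' d2 by simp
  also have "elem_chain (sinv T t) (e \<cdot> (?m \<cdot> f)) = - elem_chain t f"
    using elem_chain_sinv[OF t d2(2)] by (simp add: mf em)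
  also have "elem_chain k (?m \<cdot> f) = C1_act X R ?m (elem_chain k e)"
    using elem_chain_act[of k ?m e] K_defined_at[OF e k] k' c by (simp add: mf)
  finally show "elem_chain (sinv T t \<odot> k \<odot> t) f = C1_act X R ?m (elem_chain k e)"
    by simp
qed

lemma phi_inj:
  "\<lbrakk>e \<in> idems M; C \<in> carrier (abelianization (K e)); D \<in> carrier (abelianization (K e)); phi e C = phi e D\<rbrakk>
    \<Longrightarrow> C = D"
  using phi_iso[of e] by (auto simp: iso_def bij_betw_def dest: inj_onD)

lemma ab_class_self:
  assumes "e \<in> idems M" "k \<in> carrier (K e)"
  shows "k \<in> ab_class (K e) k" "ab_class (K e) k \<in> carrier (abelianization (K e))"
    "phi e (ab_class (K e) k) = elem_chain k e"
proof -
  interpret K: group "K e"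
    by (rule group_K) fact
  show self: "k \<in> ab_class (K e) k"
    unfolding ab_class_def by (rule K.rcos_self[OF assms(2) K.derived_is_subgroup]) simp
  show cl: "ab_class (K e) k \<in> carrier (abelianization (K e))"
    using ab_class_hom[OF assms(1)] assms(2) by (auto simp: hom_def)
  show "phi e (ab_class (K e) k) = elem_chain k e"
    by (rule phi_eq(2)[OF assms(1) cl self])
qed

text \<open>By \<open>elem_chain_conj\<close> all choices of a representative and of a preimage of
  \<open>m\<close> give classes with the same image under \<open>phi\<close>. As \<open>phi\<close>
  is injective they are one class, and the union in \<open>K_act\<close> collapses to it.\<close>

lemma K_act_eq:
  assumes e: "e \<in> idems M" and C: "C \<in> carrier (abelianization (K e))" and m: "m \<in> carrier M"
    and f: "f = sinv M m \<cdot> e \<cdot> m"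
  obtains D where "K_act X R (e, C) m = (f, D)" "D \<in> carrier (abelianization (K f))"
    "phi f D = C1_act X R m (phi e C)"
proof -
  have fi: "f \<in> idems M"
    using e m f by (simp add: M.conj_idem)
  obtain l where l: "l \<in> carrier (K e)" "C = ab_class (K e) l"
    using C by (rule ab_class_elem)
  obtain t where t: "t \<in> carrier T" "psi X R t = m"
    using m by (rule psi_surj)
  define D where "D = ab_class (K f) (sinv T t \<odot> l \<odot> t)"
  have spec: "ab_class (K f) (sinv T u \<odot> k \<odot> u) \<in> carrier (abelianization (K f)) \<and>
      phi f (ab_class (K f) (sinv T u \<odot> k \<odot> u)) = C1_act X R m (phi e C)"
    if "k \<in> C" "u \<in> carrier T" "psi X R u = m" for k u
    using phi_eq[OF e C that(1)] elem_chain_conj[OF e _ that(2), of k f] ab_class_self[OF fi] that(3) f by simp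
  have lC: "l \<in> C"
    using ab_class_self(1)[OF e l(1)] l(2) by simp
  have D: "D \<in> carrier (abelianization (K f))" "phi f D = C1_act X R m (phi e C)"
    using spec[OF lC t] by (simp_all add: D_def)
  have "ab_class (K f) (sinv T u \<odot> k \<odot> u) = D" if "k \<in> C" "u \<in> carrier T" "psi X R u = m" for k u
    using spec[OF that] D by (intro phi_inj[OF fi]) simp_all
  then have "(\<Union>k\<in>C. \<Union>u\<in>{u \<in> carrier T. psi X R u = m}. ab_class (K f) (sinv T u \<odot> k \<odot> u)) = D"
    using lC t by (auto 0 4)
  then have "K_act X R (e, C) m = (f, D)"
    by (simp add: K_act_def Let_def flip: f)
  with D show thesis
    using that by blast
qed

lemma relation_module_simps:
  "fib (relation_module X R) e = abelianization (K e)"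
  "res (relation_module X R) e f C = snd (K_act X R (e, C) f)"
  "act (relation_module X R) = K_act X R"
  by (simp_all add: relation_module_def)

lemma K_res:
  assumes "e \<in> idems M" "f \<in> idems M" "nat_le M f e" "C \<in> carrier (abelianization (K e))"
  shows "res (relation_module X R) e f C \<in> carrier (abelianization (K f))"
    and "phi f (res (relation_module X R) e f C) = C1_act X R f (phi e C)"
  using K_act_eq[OF assms(1,4) idems_closed[OF assms(2)], of f] conj_of_le[OF assms(1-3)]
  by (metis relation_module_simps(2) snd_conv)+

lemma lmodule_iso_phi: "lmodule_iso M (relation_module X R) (sch_homology_module X R) phi"
  unfolding lmodule_iso_def
proof (intro conjI ballI impI)
  fix p s assume "p \<in> total M (relation_module X R)" and s: "s \<in> carrier M"
  then obtain e C where p: "p = (e, C)" "e \<in> idems M" "C \<in> carrier (abelianization (K e))"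
    by (auto simp: total_def relation_module_simps)
  show "total_map phi (act (relation_module X R) p s) = act (sch_homology_module X R) (total_map phi p) s"
    by (rule K_act_eq[OF p(2,3) s refl]) (simp add: p(1) total_map_def relation_module_simps H_act)
qed (simp_all add: phi_iso relation_module_simps(1) K_res H_res)

lemma lausch_module_K: "lausch_module M (relation_module X R)"
proof (rule lausch_module.transport[OF lausch_module_H lmodule_iso_phi])
  fix p s assume "p \<in> total M (relation_module X R)" and s: "s \<in> carrier M"
  then obtain e C where p: "p = (e, C)" "e \<in> idems M" "C \<in> carrier (abelianization (K e))"
    by (auto simp: total_def relation_module_simps)
  show "act (relation_module X R) p s \<in> total M (relation_module X R)"
    by (rule K_act_eq[OF p(2,3) s refl])
      (use p s in \<open>simp add: total_def relation_module_simps M.conj_idem\<close>)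
qed (simp_all add: comm_group_K_ab relation_module_simps(1) K_res)

end

theorem theorem3p5:
  fixes X :: "'x set" and R :: "('x word \<times> 'x word) set"
  assumes "R \<subseteq> carrier (free_monoid X) \<times> carrier (free_monoid X)"
  shows "lausch_module (pres_monoid X R) (relation_module X R) \<and>
    lausch_module (pres_monoid X R) (sch_homology_module X R) \<and>
    lmodule_isomorphic (pres_monoid X R) (relation_module X R) (sch_homology_module X R)"
proof -
  interpret presentation X R
    by unfold_locales (rule assms)
  show ?thesis
    using lausch_module_K lausch_module_H lmodule_iso_phi by (auto simp: lmodule_isomorphic_def)
qed

end
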